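(* Let $n\ge2$, let $(V_1,\ldots,V_n)$ be an $n$-isometry on a Hilbert space $\mathcal{H}$, let $V=\prod_{i=1}^nV_i$, $\mathcal{W}=\ker V^*$, $\tilde V_i=\prod_{j\ne i}V_j$, $\tilde{\mathcal{W}}_i=\ker\tilde V_i^*\subseteq\mathcal{W}$, $U_i=(P_{\mathcal{W}}V_i+\tilde V_i^* )|_{\mathcal{W}}$ (a unitary on $\mathcal{W}$), and $\Phi_i(z)=U_i(P_{\tilde{\mathcal{W}}_i}+zP_{\tilde{\mathcal{W}}_i}^\perp)$ for $z\in\mathbb{D}$, $i=1,\ldots,n$. Let $(M_{\Psi_1},\ldots,M_{\Psi_n})$ be a model $n$-isometry on $H^2_{\mathcal{E}}(\mathbb{D})$, for some Hilbert space $\mathcal{E}$, with unitary operators $\{\tilde U_i\}_{i=1}^n$ and orthogonal projections $\{\tilde P_i\}_{i=1}^n$ on $\mathcal{E}$, so that $\Psi_i(z)=\tilde U_i(\tilde P_i^\perp+z\tilde P_i)$. Then: (a) $(M_{\Phi_1},\ldots,M_{\Phi_n})$ is a model $n$-isometry on $H^2_{\mathcal{W}}(\mathbb{D})$. (b) $(V_1,\ldots,V_n)$ and $(M_{\Phi_1},\ldots,M_{\Phi_n})$ are unitarily equivalent. (c) $(V_1,\ldots,V_n)$ and $(M_{\Psi_1},\ldots,M_{\Psi_n})$ are unitarily equivalent if and only if there exists a unitary operator $W:\mathcal{W}\to\mathcal{E}$ such that $WU_i=\tilde U_iW$ and $WP_{\tilde{\mathcal{W}}_i}^\perp=\tilde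 P_iW$ for all $i=1,\ldots,n$.
   Context: An isometry $X$ is a shift if $X^{*m}\to0$ strongly as $m\to\infty$. An $n$-isometry on $\mathcal{H}$ ($n\ge 2$) is an $n$-tuple of commuting isometries on $\mathcal{H}$ whose product is a shift. For a Hilbert space $\mathcal{E}$, $H^2_{\mathcal{E}}(\mathbb{D})$ is the $\mathcal{E}$-valued Hardy space on the unit disc and, for a bounded holomorphic $\mathcal{B}(\mathcal{E})$-valued function $\Phi$ on $\mathbb{D}$, $M_\Phi$ is the operator of multiplication by $\Phi$ on $H^2_{\mathcal{E}}(\mathbb{D})$. Model $n$-isometry: let $\mathcal{E}$ be a Hilbert space, $U_1,\ldots,U_n$ unitary operators on $\mathcal{E}$ and $P_1,\ldots,P_n$ orthogonal projections on $\mathcal{E}$ (with $P_i^\perp=I_{\mathcal{E}}-P_i$), and put $\Phi_i(z)=U_i(P_i^\perp+zP_i)$, $z\in\mathbb{D}$. The tuple $(M_{\Phi_1},\ldots,M_{\Phi_n})$ on $H^2_{\mathcal{E}}(\mathbb{D})$ is a model $n$-isometry if: (a) $U_iU_j=U_jU_i$ for all $i,j$; (b) $U_1\cdots U_n=I_{\mathcal{E}}$; (c) $P_i+U_i^*P_jU_i=P_j+U_j^*P_iU_j\le I_{\mathcal{E}}$ for all $i\ne j$; (d) $P_1+U_1^*P_2U_1+U_1^*U_2^*P_3U_2U_1+\cdots+U_1^*U_2^*\cdots U_{n-1}^*P_nU_{n-1}\cdots U_2U_1=I_{\mathcal{E}}$. $P_{\mathcal{W}}$ is the orthogonal projection of $\mathcal{H}$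 onto $\mathcal{W}$; $P_{\tilde{\mathcal{W}}_i}\in\mathcal{B}(\mathcal{W})$ is the orthogonal projection of $\mathcal{W}$ onto $\tilde{\mathcal{W}}_i$ and $P_{\tilde{\mathcal{W}}_i}^\perp=I_{\mathcal{W}}-P_{\tilde{\mathcal{W}}_i}$. Two $n$-tuples $(A_i)$ on $\mathcal{H}$ and $(B_i)$ on $\mathcal{K}$ are unitarily equivalent if there is a unitary $U:\mathcal{H}\to\mathcal{K}$ with $UA_i=B_iU$ for all $i$. *)

theory Defs
  imports "HOL-Analysis.Analysis"
begin

section \<open>Complex Hilbert spaces\<close>

text \<open>The inner product is linear in its first argument.\<close>

class complex_hilbert_space = real_inner + banach +
  fixes scaleC :: "complex \<Rightarrow> 'a \<Rightarrow> 'a"  (infixr \<open>*\<^sub>C\<close> 75)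
    and cinner :: "'a \<Rightarrow> 'a \<Rightarrow> complex"
  assumes scaleC_add_right: "c *\<^sub>C (x + y) = c *\<^sub>C x + c *\<^sub>C y"
    and scaleC_add_left: "(c + d) *\<^sub>C x = c *\<^sub>C x + d *\<^sub>C x"
    and scaleC_scaleC: "c *\<^sub>C d *\<^sub>C x = (c * d) *\<^sub>C x"
    and scaleR_scaleC: "r *\<^sub>R x = complex_of_real r *\<^sub>C x"
    and cinner_commute: "cinner x y = cnj (cinner y x)"
    and cinner_add_left: "cinner (x + y) z = cinner x z + cinner y z"
    and cinner_scaleC_left: "cinner (c *\<^sub>C x) y = c * cinner x y"
    and inner_cinner: "x \<bullet> y = Re (cinner x y)"

instantiation complex :: complex_hilbert_space
begin
definition "scaleC = ((*) :: complex \<Rightarrow> complex \<Rightarrow> complex)"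
definition "cinner x y = x * cnj y" for x y :: complex
instance
  by standard (auto simp: scaleC_complex_def cinner_complex_def inner_complex_def scaleR_conv_of_real algebra_simps)
end

context complex_hilbert_space
begin

lemma scaleC_one [simp]: "1 *\<^sub>C x = x"
  using scaleR_scaleC[of 1 x] scaleR_one[of x] by simp

lemma scaleC_zero_left [simp]: "0 *\<^sub>C x = 0"
  using scaleC_add_left[of 0 0 x] by simp

lemma scaleC_zero_right [simp]: "c *\<^sub>C 0 = 0"
  using scaleC_add_right[of c 0 0] by simp

lemma scaleC_minus1: "(-1) *\<^sub>C x = - x"
proof -
  have "x + (-1) *\<^sub>C x = 0"
    using scaleC_add_left[of 1 "-1" x] by simp
  then show ?thesis
    by (simp add: minus_unique)
qed

lemma scaleC_left_commute: "c *\<^sub>C d *\<^sub>C x = d *\<^sub>C c *\<^sub>C x"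
  by (simp add: scaleC_scaleC mult.commute)

lemma scaleC_minus_right: "c *\<^sub>C (- x) = - (c *\<^sub>C x)"
  by (metis scaleC_left_commute scaleC_minus1)

lemma scaleC_diff_right: "c *\<^sub>C (x - y) = c *\<^sub>C x - c *\<^sub>C y"
  using scaleC_add_right[of c x "- y"] by (simp add: scaleC_minus_right)

lemma cinner_zero_left [simp]: "cinner 0 x = 0"
  using cinner_add_left[of 0 0 x] by simp

lemma cinner_self: "cinner x x = complex_of_real ((norm x)\<^sup>2)"
proof -
  have "Im (cinner x x) = 0"
    using arg_cong[OF cinner_commute[of x x], of Im] by simp
  moreover have "Re (cinner x x) = (norm x)\<^sup>2"
    by (simp add: inner_cinner[symmetric] power2_norm_eq_inner)
  ultimately show ?thesis
    by (simp add: complex_eq_iff)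
qed

lemma norm_scaleC: "norm (c *\<^sub>C x) = cmod c * norm x"
proof -
  have "complex_of_real ((norm (c *\<^sub>C x))\<^sup>2) = c * cnj (c * cinner x x)"
    by (simp only: cinner_self[symmetric] cinner_scaleC_left cinner_commute[of x "c *\<^sub>C x"])
  also have "\<dots> = complex_of_real ((cmod c * norm x)\<^sup>2)"
    by (simp add: cinner_self power_mult_distrib mult.assoc[symmetric] complex_norm_square[symmetric])
  finally have "(norm (c *\<^sub>C x))\<^sup>2 = (cmod c * norm x)\<^sup>2"
    by (simp only: of_real_eq_iff)
  then show ?thesis
    by simp
qed

lemma cmod_cinner_le: "cmod (cinner x y) \<le> norm x * norm y"
proof (cases "cinner x y = 0")
  case False
  define c where "c = cnj (cinner x y) / cmod (cinner x y)"
  have c: "cmod c = 1"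
    using False by (simp add: c_def norm_divide)
  have "c * cinner x y = cmod (cinner x y)"
    using False complex_norm_square[of "cinner x y"]
    by (simp add: c_def field_simps power2_eq_square)
  then have "cmod (cinner x y) = (c *\<^sub>C x) \<bullet> y"
    by (simp add: inner_cinner cinner_scaleC_left)
  also have "\<dots> \<le> norm (c *\<^sub>C x) * norm y"
    by (rule norm_cauchy_schwarz)
  finally show ?thesis
    by (simp add: norm_scaleC c)
qed simp

end

lemma bounded_linear_scaleC: "bounded_linear (scaleC c)"
  by (rule bounded_linear_intro[where K = "cmod c"])
     (auto simp: scaleC_add_right scaleR_scaleC norm_scaleC intro: scaleC_left_commute)

lemma bounded_linear_cinner_left: "bounded_linear (\<lambda>x. cinner x y)"
  by (rule bounded_linear_intro[where K = "norm y"])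
     (auto simp: cinner_add_left scaleR_scaleC cinner_scaleC_left scaleC_complex_def cmod_cinner_le)


section \<open>The Hardy space of a Hilbert space\<close>

text \<open>
  Elements of the Hardy space are the functions on the open unit disc whose power series
  has square-summable coefficients; as HOL functions they are extended by 0.
\<close>

definition square_summable :: "(nat \<Rightarrow> 'a::complex_hilbert_space) \<Rightarrow> bool" where
  "square_summable a \<longleftrightarrow> summable (\<lambda>k. (norm (a k))\<^sup>2)"

definition disc_series :: "(nat \<Rightarrow> 'a::complex_hilbert_space) \<Rightarrow> complex \<Rightarrow> 'a" where
  "disc_series a = (\<lambda>z. if z \<in> ball 0 1 then \<Sum>k. z ^ k *\<^sub>C a k else 0)"

typedef (overloaded) 'a hardy = "{disc_series (a :: nat \<Rightarrow> 'a::complex_hilbert_space) | a. square_summable a}"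
  morphisms hardy_eval Abs_hardy
  by (auto simp: square_summable_def intro!: exI[of _ "\<lambda>_. 0"])

text \<open>The coefficients are unique, see \<open>disc_series_inject\<close> below.\<close>

definition hardy_coeff :: "'a::complex_hilbert_space hardy \<Rightarrow> nat \<Rightarrow> 'a" where
  "hardy_coeff f = (THE a. square_summable a \<and> hardy_eval f = disc_series a)"

lemma square_summable_zero: "square_summable (\<lambda>_. 0)"
  by (simp add: square_summable_def)

lemma square_summable_scaleC: "square_summable a \<Longrightarrow> square_summable (\<lambda>k. c *\<^sub>C a k)"
  by (simp add: square_summable_def norm_scaleC power_mult_distrib)

lemma square_summable_add:
  assumes "square_summable a" "square_summable b"
  shows "square_summable (\<lambda>k. a k + b k)"
  unfolding square_summable_def
proof (rule summable_comparison_test'[where N = 0])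
  show "summable (\<lambda>k. 2 * (norm (a k))\<^sup>2 + 2 * (norm (b k))\<^sup>2)"
    using assms by (intro summable_add summable_mult) (auto simp: square_summable_def)
  fix k :: nat
  have "(norm (a k + b k))\<^sup>2 \<le> (norm (a k) + norm (b k))\<^sup>2"
    by (intro power_mono norm_triangle_ineq) auto
  also have "\<dots> \<le> 2 * (norm (a k))\<^sup>2 + 2 * (norm (b k))\<^sup>2"
    using sum_squares_bound[of "norm (a k)" "norm (b k)"] by (simp add: power2_sum)
  finally show "norm ((norm (a k + b k))\<^sup>2) \<le> 2 * (norm (a k))\<^sup>2 + 2 * (norm (b k))\<^sup>2"
    by simp
qed

lemma summable_mult_norms:
  assumes "summable (\<lambda>k. (f k :: real)\<^sup>2)" "summable (\<lambda>k. (g k)\<^sup>2)"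
  shows "summable (\<lambda>k. f k * g k)"
proof (rule summable_comparison_test'[where N = 0])
  show "summable (\<lambda>k. (f k)\<^sup>2 + (g k)\<^sup>2)"
    using assms by (rule summable_add)
  fix k
  have "2 * (\<bar>f k\<bar> * \<bar>g k\<bar>) \<le> \<bar>f k\<bar>\<^sup>2 + \<bar>g k\<bar>\<^sup>2"
    using sum_squares_bound[of "\<bar>f k\<bar>" "\<bar>g k\<bar>"] by (simp add: mult.assoc)
  moreover have "0 \<le> \<bar>f k\<bar> * \<bar>g k\<bar>"
    by simp
  ultimately have "\<bar>f k\<bar> * \<bar>g k\<bar> \<le> \<bar>f k\<bar>\<^sup>2 + \<bar>g k\<bar>\<^sup>2"
    by linarith
  then show "norm (f k * g k) \<le> (f k)\<^sup>2 + (g k)\<^sup>2"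
    by (simp add: abs_mult)
qed

lemma summable_cinner:
  assumes "square_summable a" "square_summable b"
  shows "summable (\<lambda>k. cinner (a k) (b k))"
proof (rule summable_comparison_test'[where N = 0])
  show "summable (\<lambda>k. norm (a k) * norm (b k))"
    using assms by (intro summable_mult_norms) (auto simp: square_summable_def)
qed (rule cmod_cinner_le)

lemma summable_disc_series:
  fixes a :: "nat \<Rightarrow> 'a::complex_hilbert_space"
  assumes "square_summable a" "z \<in> ball 0 1"
  shows "summable (\<lambda>k. z ^ k *\<^sub>C a k)"
proof (rule summable_comparison_test'[where N = 0])
  have "summable (\<lambda>k. ((cmod z)\<^sup>2) ^ k)"
    using assms by (intro summable_geometric) (auto simp: abs_square_less_1)
  then have "summable (\<lambda>k. (cmod z ^ k)\<^sup>2)"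
    by (simp add: power_mult[symmetric] mult.commute)
  then show "summable (\<lambda>k. cmod z ^ k * norm (a k))"
    using assms by (intro summable_mult_norms) (auto simp: square_summable_def)
qed (simp add: norm_scaleC norm_power)

lemma disc_series_zero: "disc_series (\<lambda>_. 0) = (\<lambda>z. 0 :: 'a::complex_hilbert_space)"
  by (simp add: disc_series_def fun_eq_iff)

lemma disc_series_add:
  assumes "square_summable a" "square_summable b"
  shows "disc_series (\<lambda>k. a k + b k) = (\<lambda>z. disc_series a z + disc_series b z)"
  using assms by (auto simp: disc_series_def fun_eq_iff scaleC_add_right suminf_add summable_disc_series)

lemma disc_series_scaleC:
  assumes "square_summable a"
  shows "disc_series (\<lambda>k. c *\<^sub>C a k) = (\<lambda>z. c *\<^sub>C disc_series a z)"
  using assms bounded_linear.suminf[OF bounded_linear_scaleC[of c] summable_disc_series[OF assms]]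
  by (auto simp: disc_series_def fun_eq_iff scaleC_left_commute[of _ c])

lemma disc_series_minus:
  assumes "square_summable a"
  shows "disc_series (\<lambda>k. - a k) = (\<lambda>z. - disc_series a z)"
  using disc_series_scaleC[OF assms, of "-1"] by (simp only: scaleC_minus1)

lemma disc_series_inject:
  fixes a :: "nat \<Rightarrow> 'a::complex_hilbert_space"
  assumes a: "square_summable a" and b: "square_summable b" and eq: "disc_series a = disc_series b"
  shows "a = b"
proof -
  define c where "c k = a k + (-1) *\<^sub>C b k" for k
  have c: "square_summable c"
    unfolding c_def by (intro square_summable_add square_summable_scaleC a b)
  have c0: "disc_series c z = 0" for z
    unfolding c_def
    unfolding disc_series_add[OF a square_summable_scaleC[OF b]]
    unfolding disc_series_scaleC[OF b]
    by (simp add: eq scaleC_minus1)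
  have "cinner (c k) y = 0" for k y
  proof -
    have s: "(\<lambda>k. cinner (c k) y * z ^ k) sums 0" if "z \<in> ball 0 1" for z
    proof -
      have "(\<lambda>k. z ^ k *\<^sub>C c k) sums 0"
        using summable_sums[OF summable_disc_series[OF c that]] c0[of z] that
        by (simp add: disc_series_def)
      from bounded_linear.sums[OF bounded_linear_cinner_left this, of y] show ?thesis
        by (simp add: cinner_scaleC_left mult.commute)
    qed
    define F where "F = Abs_fps (\<lambda>k. cinner (c k) y)"
    have "fps_conv_radius F \<ge> norm (1 / 2 :: complex)"
      unfolding fps_conv_radius_def F_def
      by (rule conv_radius_geI) (use sums_summable[OF s[of "1 / 2"]] in \<open>simp add: norm_divide\<close>)
    then have r: "fps_conv_radius F > 0"
      by (rule less_le_trans[rotated]) (simp add: norm_divide)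
    have "eventually (\<lambda>z. z \<in> ball 0 1) (nhds (0 :: complex))"
      by (intro eventually_nhds_in_open) auto
    then have "eventually (\<lambda>z. eval_fps F z = eval_fps 0 z) (nhds 0)"
      by (rule eventually_mono) (simp add: eval_fps_def F_def sums_unique[OF s, symmetric])
    then have "F = 0"
      using r by (intro eval_fps_eqD) auto
    then show ?thesis
      by (simp add: F_def fps_eq_iff)
  qed
  then have "c k = 0" for k
    using cinner_self[of "c k"] by simp
  then show ?thesis
    by (simp add: c_def fun_eq_iff scaleC_minus1)
qed

lemma
  fixes f :: "'a::complex_hilbert_space hardy"
  shows square_summable_hardy_coeff: "square_summable (hardy_coeff f)"
    and hardy_eval_eq: "hardy_eval f = disc_series (hardy_coeff f)"
proof -
  obtain a where "square_summable a" "hardy_eval f = disc_series a"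
    using hardy_eval[of f] by blast
  then have "\<exists>!a. square_summable a \<and> hardy_eval f = disc_series a"
    using disc_series_inject by metis
  from theI'[OF this] show "square_summable (hardy_coeff f)" "hardy_eval f = disc_series (hardy_coeff f)"
    by (simp_all add: hardy_coeff_def)
qed

lemma hardy_coeff_eqI: "square_summable a \<Longrightarrow> hardy_eval f = disc_series a \<Longrightarrow> hardy_coeff f = a"
  by (rule disc_series_inject[OF square_summable_hardy_coeff]) (simp_all add: hardy_eval_eq[symmetric])

lemma hardy_eval_Abs: "square_summable a \<Longrightarrow> hardy_eval (Abs_hardy (disc_series a)) = disc_series a"
  by (rule Abs_hardy_inverse) blast

lemma hardy_coeff_Abs: "square_summable a \<Longrightarrow> hardy_coeff (Abs_hardy (disc_series a)) = a"
  by (simp add: hardy_coeff_eqI hardy_eval_Abs)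

lemma hardy_eqI: "(\<And>k. hardy_coeff f k = hardy_coeff g k) \<Longrightarrow> f = g"
  unfolding hardy_eval_inject[symmetric] hardy_eval_eq disc_series_def by presburger


instantiation hardy :: (complex_hilbert_space) real_inner
begin

definition "0 = Abs_hardy (\<lambda>_. 0 :: 'a)"
definition "f + g = Abs_hardy (\<lambda>z. hardy_eval f z + hardy_eval g z)" for f g :: "'a hardy"
definition "- f = Abs_hardy (\<lambda>z. - hardy_eval f z)" for f :: "'a hardy"
definition "f - g = f + - g" for f g :: "'a hardy"
definition "r *\<^sub>R f = Abs_hardy (\<lambda>z. r *\<^sub>R hardy_eval f z)" for f :: "'a hardy"
definition "f \<bullet> g = (\<Sum>k. hardy_coeff f k \<bullet> hardy_coeff g k)" for f g :: "'a hardy"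
definition "norm f = sqrt (f \<bullet> f)" for f :: "'a hardy"
definition "dist f g = norm (f - g)" for f g :: "'a hardy"
definition "sgn f = inverse (norm f) *\<^sub>R f" for f :: "'a hardy"
definition "uniformity = (INF e\<in>{0 <..}. principal {(f :: 'a hardy, g). dist f g < e})"
definition "open S \<longleftrightarrow> (\<forall>f\<in>S. \<forall>\<^sub>F (f', g) in uniformity. f' = f \<longrightarrow> g \<in> S)" for S :: "'a hardy set"

lemma hardy_coeff_zero: "hardy_coeff (0 :: 'a hardy) k = 0"
  using hardy_coeff_Abs[OF square_summable_zero, where 'a = 'a]
  by (simp add: zero_hardy_def disc_series_zero)

lemma hardy_coeff_add: "hardy_coeff (f + g :: 'a hardy) k = hardy_coeff f k + hardy_coeff g k"
  unfolding plus_hardy_def hardy_eval_eq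
  by (simp add: disc_series_add[symmetric] hardy_coeff_Abs square_summable_add square_summable_hardy_coeff)

lemma hardy_coeff_scaleR: "hardy_coeff (r *\<^sub>R f :: 'a hardy) k = r *\<^sub>R hardy_coeff f k"
  unfolding scaleR_hardy_def hardy_eval_eq scaleR_scaleC
  by (simp add: disc_series_scaleC[symmetric] hardy_coeff_Abs square_summable_scaleC square_summable_hardy_coeff)

lemma hardy_coeff_minus: "hardy_coeff (- f :: 'a hardy) k = - hardy_coeff f k"
  using square_summable_scaleC[OF square_summable_hardy_coeff[of f], of "-1"]
  unfolding uminus_hardy_def hardy_eval_eq
  by (simp add: disc_series_minus[symmetric] hardy_coeff_Abs square_summable_hardy_coeff scaleC_minus1)

lemma sums_inner_hardy: "(\<lambda>k. hardy_coeff f k \<bullet> hardy_coeff g k) sums (f \<bullet> (g :: 'a hardy))"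
  unfolding inner_hardy_def inner_cinner
  by (intro summable_sums summable_Re summable_cinner square_summable_hardy_coeff)

lemma sums_norm_hardy: "(\<lambda>k. (norm (hardy_coeff f k))\<^sup>2) sums (f \<bullet> (f :: 'a hardy))"
  using sums_inner_hardy[of f f] by (simp add: power2_norm_eq_inner)

instance
proof
  fix f g h :: "'a hardy" and r s :: real
  note [simp] = hardy_coeff_zero hardy_coeff_add hardy_coeff_scaleR hardy_coeff_minus
  show "f + g + h = f + (g + h)" "f + g = g + f" "0 + f = f" "- f + f = 0"
    "r *\<^sub>R (f + g) = r *\<^sub>R f + r *\<^sub>R g" "(r + s) *\<^sub>R f = r *\<^sub>R f + s *\<^sub>R f"
    "r *\<^sub>R s *\<^sub>R f = (r * s) *\<^sub>R f" "1 *\<^sub>R f = f"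
    by (auto intro!: hardy_eqI simp: scaleR_add_right scaleR_add_left)
  show "f - g = f + - g" "dist f g = norm (f - g)" "norm f = sqrt (f \<bullet> f)" "sgn f = inverse (norm f) *\<^sub>R f"
    "uniformity = (INF e\<in>{0 <..}. principal {(f :: 'a hardy, g). dist f g < e})"
    by (fact minus_hardy_def dist_hardy_def norm_hardy_def sgn_hardy_def uniformity_hardy_def)+
  show "open S \<longleftrightarrow> (\<forall>f\<in>S. \<forall>\<^sub>F (f', g) in uniformity. f' = f \<longrightarrow> g \<in> S)" for S :: "'a hardy set"
    by (fact open_hardy_def)
  show "f \<bullet> g = g \<bullet> f"
    by (simp add: inner_hardy_def inner_commute)
  show "(f + g) \<bullet> h = f \<bullet> h + g \<bullet> h"
    by (rule sums_unique2[OF sums_inner_hardy])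
       (use sums_add[OF sums_inner_hardy[of f h] sums_inner_hardy[of g h]] in \<open>simp add: inner_add_left\<close>)
  show "(r *\<^sub>R f) \<bullet> g = r * (f \<bullet> g)"
    by (rule sums_unique2[OF sums_inner_hardy]) (use sums_mult[OF sums_inner_hardy[of f g], of r] in simp)
  show "0 \<le> f \<bullet> f"
    by (rule sums_le[OF _ sums_zero sums_norm_hardy]) simp
  have "f = 0" if "f \<bullet> f = 0"
  proof (rule hardy_eqI)
    fix k
    have "(\<Sum>k. (norm (hardy_coeff f k))\<^sup>2) = 0"
      using sums_unique[OF sums_norm_hardy[of f]] that by simp
    then show "hardy_coeff f k = hardy_coeff 0 k"
      using suminf_eq_zero_iff[OF sums_summable[OF sums_norm_hardy[of f]]] by simp
  qed
  moreover have "(0 :: 'a hardy) \<bullet> 0 = 0"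
    by (simp add: inner_hardy_def)
  ultimately show "f \<bullet> f = 0 \<longleftrightarrow> f = 0"
    by blast
qed

end

lemma hardy_coeff_diff: "hardy_coeff (f - g) k = hardy_coeff f k - hardy_coeff g k"
  unfolding minus_hardy_def hardy_coeff_add hardy_coeff_minus by simp

lemma sum_norm_coeff_le: "(\<Sum>k<N. (norm (hardy_coeff f k))\<^sup>2) \<le> (norm f)\<^sup>2"
  unfolding power2_norm_eq_inner[of f] sums_unique[OF sums_norm_hardy[of f]]
  by (intro sum_le_suminf sums_summable[OF sums_norm_hardy]) auto

lemma norm_hardy_coeff_le: "norm (hardy_coeff f k) \<le> norm f"
proof (rule power2_le_imp_le)
  have "(norm (hardy_coeff f k))\<^sup>2 \<le> (\<Sum>j<Suc k. (norm (hardy_coeff f j))\<^sup>2)"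
    by (rule member_le_sum) auto
  also have "\<dots> \<le> (norm f)\<^sup>2"
    by (rule sum_norm_coeff_le)
  finally show "(norm (hardy_coeff f k))\<^sup>2 \<le> (norm f)\<^sup>2" .
qed simp

lemma Cauchy_hardy_convergent:
  fixes X :: "nat \<Rightarrow> 'a::complex_hilbert_space hardy"
  assumes X: "Cauchy X"
  shows "convergent X"
proof -
  have "Cauchy (\<lambda>n. hardy_coeff (X n) k)" for k
  proof (rule metric_CauchyI)
    fix e :: real
    assume "e > 0"
    then obtain M where M: "\<And>m n. m \<ge> M \<Longrightarrow> n \<ge> M \<Longrightarrow> dist (X m) (X n) < e"
      using metric_CauchyD[OF X, of e] by auto
    have "dist (hardy_coeff (X m) k) (hardy_coeff (X n) k) < e" if "m \<ge> M" "n \<ge> M" for m n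
      using norm_hardy_coeff_le[of "X m - X n" k] M[OF that] by (simp add: dist_norm hardy_coeff_diff)
    then show "\<exists>M. \<forall>m\<ge>M. \<forall>n\<ge>M. dist (hardy_coeff (X m) k) (hardy_coeff (X n) k) < e"
      by blast
  qed
  then have "\<exists>l. (\<lambda>n. hardy_coeff (X n) k) \<longlonglongrightarrow> l" for k
    unfolding convergent_def[symmetric] by (rule Cauchy_convergent)
  then obtain a where a: "(\<lambda>n. hardy_coeff (X n) k) \<longlonglongrightarrow> a k" for k
    by metis
  have *: "square_summable (\<lambda>k. hardy_coeff (X m) k - a k) \<and>
      (\<Sum>k. (norm (hardy_coeff (X m) k - a k))\<^sup>2) \<le> e\<^sup>2"
    if e: "e > 0" and M: "\<And>m n. m \<ge> M \<Longrightarrow> n \<ge> M \<Longrightarrow> dist (X m) (X n) < e" and m: "m \<ge> M"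
    for e M m
  proof -
    have bnd: "(\<Sum>k<N. (norm (hardy_coeff (X m) k - a k))\<^sup>2) \<le> e\<^sup>2" for N
    proof (rule tendsto_upperbound)
      show "(\<lambda>n. \<Sum>k<N. (norm (hardy_coeff (X m) k - hardy_coeff (X n) k))\<^sup>2)
          \<longlonglongrightarrow> (\<Sum>k<N. (norm (hardy_coeff (X m) k - a k))\<^sup>2)"
        by (intro tendsto_intros a)
      have "(\<Sum>k<N. (norm (hardy_coeff (X m) k - hardy_coeff (X n) k))\<^sup>2) \<le> e\<^sup>2" if "n \<ge> M" for n
      proof -
        have "(\<Sum>k<N. (norm (hardy_coeff (X m) k - hardy_coeff (X n) k))\<^sup>2) \<le> (norm (X m - X n))\<^sup>2"
          using sum_norm_coeff_le[of "X m - X n" N] by (simp add: hardy_coeff_diff)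
        also have "\<dots> \<le> e\<^sup>2"
          using M[OF m that] by (intro power_mono) (auto simp: dist_norm)
        finally show ?thesis .
      qed
      then show "\<forall>\<^sub>F n in sequentially. (\<Sum>k<N. (norm (hardy_coeff (X m) k - hardy_coeff (X n) k))\<^sup>2) \<le> e\<^sup>2"
        by (auto simp: eventually_sequentially)
    qed simp
    have "summable (\<lambda>k. (norm (hardy_coeff (X m) k - a k))\<^sup>2)"
      by (rule summableI_nonneg_bounded[OF _ bnd]) simp
    with suminf_le_const[OF this bnd] show ?thesis
      by (simp add: square_summable_def)
  qed
  have "square_summable a"
  proof -
    obtain M where M: "\<And>m n. m \<ge> M \<Longrightarrow> n \<ge> M \<Longrightarrow> dist (X m) (X n) < 1"
      using metric_CauchyD[OF X, of 1] by auto
    have "square_summable (\<lambda>k. hardy_coeff (X M) k + (-1) *\<^sub>C (hardy_coeff (X M) k - a k))"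
      using *[of 1 M M] M
      by (intro square_summable_add square_summable_scaleC square_summable_hardy_coeff) simp
    then show ?thesis
      by (simp add: scaleC_minus1)
  qed
  define f where "f = Abs_hardy (disc_series a)"
  have f: "hardy_coeff f = a"
    using \<open>square_summable a\<close> by (simp add: f_def hardy_coeff_Abs)
  have "X \<longlonglongrightarrow> f"
  proof (rule metric_LIMSEQ_I)
    fix r :: real
    assume "r > 0"
    then obtain M where M: "\<And>m n. m \<ge> M \<Longrightarrow> n \<ge> M \<Longrightarrow> dist (X m) (X n) < r / 2"
      using metric_CauchyD[OF X, of "r / 2"] by auto
    have "dist (X m) f < r" if "m \<ge> M" for m
    proof -
      have "(norm (X m - f))\<^sup>2 = (\<Sum>k. (norm (hardy_coeff (X m) k - a k))\<^sup>2)"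
        using sums_unique[OF sums_norm_hardy[of "X m - f"]]
        by (simp add: power2_norm_eq_inner hardy_coeff_diff f)
      also have "\<dots> \<le> (r / 2)\<^sup>2"
        using *[of "r / 2" M m] M that \<open>r > 0\<close> by simp
      finally have "norm (X m - f) \<le> r / 2"
        by (rule power2_le_imp_le) (use \<open>r > 0\<close> in simp)
      then show ?thesis
        using \<open>r > 0\<close> by (simp add: dist_norm)
    qed
    then show "\<exists>M. \<forall>n\<ge>M. dist (X n) f < r"
      by blast
  qed
  then show ?thesis
    by (rule convergentI)
qed

instantiation hardy :: (complex_hilbert_space) complex_hilbert_space
begin

definition "c *\<^sub>C f = Abs_hardy (\<lambda>z. c *\<^sub>C hardy_eval f z)" for f :: "'a hardy"
definition "cinner f g = (\<Sum>k. cinner (hardy_coeff f k) (hardy_coeff g k))" for f g :: "'a hardy"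

lemma hardy_coeff_scaleC: "hardy_coeff (c *\<^sub>C f :: 'a hardy) k = c *\<^sub>C hardy_coeff f k"
  unfolding scaleC_hardy_def hardy_eval_eq
  by (simp add: disc_series_scaleC[symmetric] hardy_coeff_Abs square_summable_scaleC square_summable_hardy_coeff)

lemma sums_cinner_hardy:
  "(\<lambda>k. cinner (hardy_coeff f k) (hardy_coeff g k)) sums cinner f (g :: 'a hardy)"
  unfolding cinner_hardy_def by (intro summable_sums summable_cinner square_summable_hardy_coeff)

instance
proof
  fix f g h :: "'a hardy" and c d :: complex and r :: real
  note [simp] = hardy_coeff_add hardy_coeff_scaleR hardy_coeff_scaleC
  show "Cauchy X \<Longrightarrow> convergent X" for X :: "nat \<Rightarrow> 'a hardy"
    by (rule Cauchy_hardy_convergent)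
  show "c *\<^sub>C (f + g) = c *\<^sub>C f + c *\<^sub>C g" "(c + d) *\<^sub>C f = c *\<^sub>C f + d *\<^sub>C f"
    "c *\<^sub>C d *\<^sub>C f = (c * d) *\<^sub>C f" "r *\<^sub>R f = complex_of_real r *\<^sub>C f"
    by (auto intro!: hardy_eqI simp: scaleC_add_right scaleC_add_left scaleC_scaleC scaleR_scaleC)
  show "cinner f g = cnj (cinner g f)"
    by (rule sums_unique2[OF sums_cinner_hardy])
       (use sums_cnj[THEN iffD2, OF sums_cinner_hardy[of g f]] in \<open>simp add: cinner_commute[symmetric]\<close>)
  show "cinner (f + g) h = cinner f h + cinner g h"
    by (rule sums_unique2[OF sums_cinner_hardy])
       (use sums_add[OF sums_cinner_hardy[of f h] sums_cinner_hardy[of g h]] in \<open>simp add: cinner_add_left\<close>)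
  show "cinner (c *\<^sub>C f) g = c * cinner f g"
    by (rule sums_unique2[OF sums_cinner_hardy])
       (use sums_mult[OF sums_cinner_hardy[of f g], of c] in \<open>simp add: cinner_scaleC_left\<close>)
  show "f \<bullet> g = Re (cinner f g)"
    by (rule sums_unique2[OF sums_inner_hardy])
       (use sums_Re[OF sums_cinner_hardy[of f g]] in \<open>simp add: inner_cinner\<close>)
qed

end


section \<open>Operators\<close>

text \<open>
  A Hilbert space is a closed subspace of a type of class \<open>complex_hilbert_space\<close>, and an
  operator on it is a function whose values outside of the subspace are irrelevant.
\<close>

definition closed_csubspace :: "'a::complex_hilbert_space set \<Rightarrow> bool" where
  "closed_csubspace S \<longleftrightarrow>
     0 \<in> S \<and> (\<forall>x\<in>S. \<forall>y\<in>S. x + y \<in> S) \<and> (\<forall>c. \<forall>x\<in>S. c *\<^sub>C x \<in> S) \<and> closed S"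

definition clinear_on :: "'a::complex_hilbert_space set \<Rightarrow> ('a \<Rightarrow> 'b::complex_hilbert_space) \<Rightarrow> bool" where
  "clinear_on S A \<longleftrightarrow>
     (\<forall>x\<in>S. \<forall>y\<in>S. A (x + y) = A x + A y) \<and> (\<forall>c. \<forall>x\<in>S. A (c *\<^sub>C x) = c *\<^sub>C A x)"

definition isometry_on ::
    "'a::complex_hilbert_space set \<Rightarrow> 'b::complex_hilbert_space set \<Rightarrow> ('a \<Rightarrow> 'b) \<Rightarrow> bool" where
  "isometry_on S T A \<longleftrightarrow> clinear_on S A \<and> A ` S \<subseteq> T \<and> (\<forall>x\<in>S. norm (A x) = norm x)"

definition unitary_on ::
    "'a::complex_hilbert_space set \<Rightarrow> 'b::complex_hilbert_space set \<Rightarrow> ('a \<Rightarrow> 'b) \<Rightarrow> bool" where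
  "unitary_on S T A \<longleftrightarrow> isometry_on S T A \<and> A ` S = T"

definition adjoint_on :: "'a::complex_hilbert_space set \<Rightarrow> ('a \<Rightarrow> 'a) \<Rightarrow> 'a \<Rightarrow> 'a" where
  "adjoint_on S A y = (THE w. w \<in> S \<and> (\<forall>x\<in>S. cinner (A x) y = cinner x w))"

definition proj :: "'a::complex_hilbert_space set \<Rightarrow> 'a \<Rightarrow> 'a" where
  "proj S x = (THE p. p \<in> S \<and> (\<forall>y\<in>S. cinner (x - p) y = 0))"

definition projection_on :: "'a::complex_hilbert_space set \<Rightarrow> ('a \<Rightarrow> 'a) \<Rightarrow> bool" where
  "projection_on S P \<longleftrightarrow> (\<exists>R. closed_csubspace R \<and> R \<subseteq> S \<and> (\<forall>x\<in>S. P x = proj R x))"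

definition op_le_on :: "'a::complex_hilbert_space set \<Rightarrow> ('a \<Rightarrow> 'a) \<Rightarrow> ('a \<Rightarrow> 'a) \<Rightarrow> bool" where
  "op_le_on S A B \<longleftrightarrow> (\<forall>x\<in>S. cinner (B x - A x) x \<in> \<real>\<^sub>\<ge>\<^sub>0)"

text \<open>\<open>op_prod A [j\<^sub>1, \<dots>, j\<^sub>m]\<close> is the product \<open>A j\<^sub>1 \<circ> \<dots> \<circ> A j\<^sub>m\<close>.\<close>

definition op_prod :: "(nat \<Rightarrow> 'a \<Rightarrow> 'a) \<Rightarrow> nat list \<Rightarrow> 'a \<Rightarrow> 'a" where
  "op_prod A js = foldr (\<lambda>j B. A j \<circ> B) js id"

definition shift :: "('a::complex_hilbert_space \<Rightarrow> 'a) \<Rightarrow> bool" where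
  "shift X \<longleftrightarrow> isometry_on UNIV UNIV X \<and> (\<forall>x. (\<lambda>m. (adjoint_on UNIV X ^^ m) x) \<longlonglongrightarrow> 0)"

text \<open>Tuples are indexed by \<open>1, \<dots>, n\<close>.\<close>

definition n_isometry :: "nat \<Rightarrow> (nat \<Rightarrow> 'a::complex_hilbert_space \<Rightarrow> 'a) \<Rightarrow> bool" where
  "n_isometry n V \<longleftrightarrow> n \<ge> 2 \<and>
     (\<forall>i\<in>{1..n}. isometry_on UNIV UNIV (V i)) \<and>
     (\<forall>i\<in>{1..n}. \<forall>j\<in>{1..n}. V i \<circ> V j = V j \<circ> V i) \<and>
     shift (op_prod V [1..<Suc n])"

definition unitarily_equivalent ::
    "nat \<Rightarrow> 'a::complex_hilbert_space set \<Rightarrow> (nat \<Rightarrow> 'a \<Rightarrow> 'a) \<Rightarrow>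
     'b::complex_hilbert_space set \<Rightarrow> (nat \<Rightarrow> 'b \<Rightarrow> 'b) \<Rightarrow> bool" where
  "unitarily_equivalent n S A T B \<longleftrightarrow>
     (\<exists>X. unitary_on S T X \<and> (\<forall>i\<in>{1..n}. \<forall>x\<in>S. X (A i x) = B i (X x)))"


section \<open>Model tuples\<close>

text \<open>
  For a closed subspace \<open>E\<close>, the functions with values in \<open>E\<close> are those with coefficients in \<open>E\<close>.
\<close>

definition H2 :: "'a::complex_hilbert_space set \<Rightarrow> 'a hardy set" where
  "H2 E = {f. \<forall>z\<in>ball 0 1. hardy_eval f z \<in> E}"

definition mult_op :: "(complex \<Rightarrow> 'a \<Rightarrow> 'a) \<Rightarrow> 'a::complex_hilbert_space hardy \<Rightarrow> 'a hardy" where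
  "mult_op \<Phi> f = (THE g. \<forall>z\<in>ball 0 1. hardy_eval g z = \<Phi> z (hardy_eval f z))"

text \<open>
  \<open>M\<close> is the model \<open>n\<close>-isometry on \<open>H2 E\<close> with unitary operators \<open>U i\<close> and orthogonal
  projections \<open>P i\<close> on \<open>E\<close>.
\<close>

definition model_isometry ::
    "nat \<Rightarrow> 'a::complex_hilbert_space set \<Rightarrow> (nat \<Rightarrow> 'a \<Rightarrow> 'a) \<Rightarrow> (nat \<Rightarrow> 'a \<Rightarrow> 'a) \<Rightarrow>
     (nat \<Rightarrow> 'a hardy \<Rightarrow> 'a hardy) \<Rightarrow> bool" where
  "model_isometry n E U P M \<longleftrightarrow>
     closed_csubspace E \<and>
     (\<forall>i\<in>{1..n}. unitary_on E E (U i)) \<and>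
     (\<forall>i\<in>{1..n}. projection_on E (P i)) \<and>
     (\<forall>i\<in>{1..n}. \<forall>f\<in>H2 E. M i f = mult_op (\<lambda>z x. U i ((x - P i x) + z *\<^sub>C P i x)) f) \<and>
     (\<forall>i\<in>{1..n}. \<forall>j\<in>{1..n}. \<forall>x\<in>E. U i (U j x) = U j (U i x)) \<and>
     (\<forall>x\<in>E. op_prod U [1..<Suc n] x = x) \<and>
     (\<forall>i\<in>{1..n}. \<forall>j\<in>{1..n}. i \<noteq> j \<longrightarrow>
        (\<forall>x\<in>E. P i x + adjoint_on E (U i) (P j (U i x)) = P j x + adjoint_on E (U j) (P i (U j x))) \<and>
        op_le_on E (\<lambda>x. P i x + adjoint_on E (U i) (P j (U i x))) (\<lambda>x. x)) \<and>
     (\<forall>x\<in>E. (\<Sum>k = 1..n.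
        op_prod (\<lambda>j. adjoint_on E (U j)) [1..<k] (P k (op_prod U (rev [1..<k]) x))) = x)"

end

theory Submission
  imports Defs
begin

text \<open>
  On \<open>W\<close> every \<open>x\<close> splits as \<open>a + Vt\<^sub>i b\<close> with \<open>b = Vt\<^sub>i\<^sup>* x\<close>, and \<open>U\<^sub>i x = V\<^sub>i a + b\<close>. Hence
  \<open>V\<^sub>i x = U\<^sub>i (x - Q\<^sub>i x) + V U\<^sub>i Q\<^sub>i x\<close> for the projection \<open>Q\<^sub>i = Vt\<^sub>i Vt\<^sub>i\<^sup>*\<close>, so that the Wold decomposition
  of the shift \<open>V\<close> intertwines \<open>V\<^sub>i\<close> with multiplication by \<open>\<Phi>\<^sub>i\<close>. Since \<open>U\<^sub>i\<close> maps the kernel of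
  \<open>(V\<^sub>1 \<dots> V\<^sub>k)\<^sup>*\<close> (\<open>i > k\<close>) as \<open>V\<^sub>i\<close> does, and the range of \<open>Q\<^sub>i\<close> onto the kernel of \<open>V\<^sub>i\<^sup>*\<close>, the sums of
  projections in the model conditions are conjugate to the projections onto kernels of
  adjoints of partial products.

  Conversely, the conditions on a model tuple make the product of its symbols equal to \<open>z\<close>. A unitary
  that intertwines \<open>V\<close> with a model tuple therefore intertwines the shift \<open>V\<close> with multiplication by \<open>z\<close>,
  maps \<open>W\<close> onto the constant functions, and the two coefficients of \<open>\<Psi>\<^sub>i\<close> can be compared.
\<close>

section \<open>Hilbert space operators\<close>

lemma cinner_add_right: "cinner x (y + z) = cinner x y + cinner x z"
  by (metis cinner_add_left cinner_commute complex_cnj_add)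

lemma cinner_scaleC_right: "cinner x (c *\<^sub>C y) = cnj c * cinner x y"
  by (metis cinner_commute cinner_scaleC_left complex_cnj_mult)

lemma cinner_minus_left: "cinner (- x) y = - cinner x y"
  using cinner_scaleC_left[of "-1" x y] by (simp add: scaleC_minus1)

lemma cinner_minus_right: "cinner x (- y) = - cinner x y"
  using cinner_scaleC_right[of x "-1" y] by (simp add: scaleC_minus1)

lemma cinner_diff_left: "cinner (x - y) z = cinner x z - cinner y z"
  using cinner_add_left[of x "- y" z] by (simp add: cinner_minus_left)

lemma cinner_diff_right: "cinner x (y - z) = cinner x y - cinner x z"
  using cinner_add_right[of x y "- z"] by (simp add: cinner_minus_right)

lemma cinner_zero_right [simp]: "cinner x 0 = 0"
  by (metis cinner_commute cinner_zero_left complex_cnj_zero)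

lemma cinner_self_eq_0 [simp]: "cinner x x = 0 \<longleftrightarrow> x = 0"
  by (simp add: cinner_self)

lemma cinner_eq_0_commute: "cinner x y = 0 \<longleftrightarrow> cinner y x = 0"
  by (metis cinner_commute complex_cnj_zero)

lemma cinner_eqI:
  assumes "\<And>x. cinner x y = cinner x z"
  shows "y = z"
  using cinner_self_eq_0[of "y - z"] assms by (simp add: cinner_diff_right)

lemma norm_add_orthogonal: "cinner x y = 0 \<Longrightarrow> (norm (x + y))\<^sup>2 = (norm x)\<^sup>2 + (norm y)\<^sup>2"
  by (simp add: power2_norm_eq_inner inner_add_left inner_add_right inner_commute[of y x] inner_cinner[of x y])

lemma closed_csubspace_UNIV: "closed_csubspace UNIV"
  by (simp add: closed_csubspace_def)

lemma closed_csubspace_diff: "closed_csubspace S \<Longrightarrow> x \<in> S \<Longrightarrow> y \<in> S \<Longrightarrow> x - y \<in> S"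
  unfolding closed_csubspace_def by (metis scaleC_minus1 diff_conv_add_uminus)

section \<open>Orthogonal projections onto closed subspaces\<close>

lemma norm_diff_scaleR:
  fixes u v :: "'a::real_inner"
  shows "(norm (u - t *\<^sub>R v))\<^sup>2 = (norm u)\<^sup>2 - 2 * t * (u \<bullet> v) + t\<^sup>2 * (norm v)\<^sup>2"
  unfolding power2_norm_eq_inner
  by (simp add: inner_diff_left inner_diff_right inner_commute[of v u] algebra_simps power2_eq_square)

text \<open>A minimizing sequence for the distance from \<open>x\<close> to \<open>S\<close> is
  Cauchy by the parallelogram law. Its limit \<open>p\<close> is a nearest point, and minimality
  along each line through \<open>p\<close> gives orthogonality.\<close>

lemma projection_exists:
  fixes x :: "'a::complex_hilbert_space"
  assumes S: "closed_csubspace S"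
  obtains p where "p \<in> S" "\<And>y. y \<in> S \<Longrightarrow> cinner (x - p) y = 0"
proof -
  note add = S[unfolded closed_csubspace_def]
  have scR: "r *\<^sub>R y \<in> S" if "y \<in> S" for r y
    using add that by (simp add: scaleR_scaleC)
  define D where "D = (\<lambda>s. (norm (x - s))\<^sup>2) ` S"
  define d where "d = Inf D"
  have D: "D \<noteq> {}" "bdd_below D"
    using add by (auto simp: D_def intro!: bdd_belowI[of _ 0])
  have d: "d \<le> (norm (x - s))\<^sup>2" if "s \<in> S" for s
    unfolding d_def using D that by (intro cInf_lower) (auto simp: D_def)
  have "\<exists>s\<in>S. (norm (x - s))\<^sup>2 < d + inverse (Suc m)" for m
    using cInf_lessD[OF D(1), of "d + inverse (Suc m)"] by (auto simp: d_def D_def)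
  then obtain s where s: "\<And>m. s m \<in> S" "\<And>m. (norm (x - s m))\<^sup>2 < d + inverse (Suc m)"
    by metis
  \<comment> \<open>Parallelogram law for \<open>x - u\<close> and \<open>x - v\<close>. The
    midpoint of two points of \<open>S\<close> lies in \<open>S\<close>, so its squared distance
    from \<open>x\<close> is at least \<open>d\<close>.\<close>
  have par: "(norm (u - v))\<^sup>2 = 2 * (norm (x - u))\<^sup>2 + 2 * (norm (x - v))\<^sup>2 - 4 * (norm (x - (1/2) *\<^sub>R (u + v)))\<^sup>2" for u v
    by (simp add: power2_norm_eq_inner inner_diff_left inner_diff_right inner_add_left inner_add_right
        inner_commute algebra_simps)
  have bnd: "(norm (s m - s k))\<^sup>2 \<le> 2 * inverse (Suc m) + 2 * inverse (Suc k)" for m k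
    using par[of "s m" "s k"] d[of "(1/2) *\<^sub>R (s m + s k)"] s(2)[of m] s(2)[of k] add s(1) scR
    by (smt (verit, best))
  have "Cauchy s"
  proof (rule metric_CauchyI)
    fix e :: real
    assume "e > 0"
    then obtain N where N: "inverse (Suc N) < e\<^sup>2 / 4"
      using reals_Archimedean[of "e\<^sup>2 / 4"] by auto
    have "dist (s m) (s k) < e" if "m \<ge> N" "k \<ge> N" for m k
    proof -
      have "inverse (Suc m) \<le> inverse (Suc N)" "inverse (Suc k) \<le> inverse (Suc N)"
        using that by (auto intro!: le_imp_inverse_le)
      then have "(norm (s m - s k))\<^sup>2 < e\<^sup>2"
        using bnd[of m k] N by linarith
      then show ?thesis
        using \<open>e > 0\<close> by (simp add: dist_norm power2_less_imp_less)
    qed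
    then show "\<exists>M. \<forall>m\<ge>M. \<forall>n\<ge>M. dist (s m) (s n) < e"
      by blast
  qed
  then obtain p where p: "s \<longlonglongrightarrow> p"
    using Cauchy_convergent convergent_def by blast
  have "p \<in> S"
    using add s(1) p closed_sequentially by blast
  have min: "(norm (x - p))\<^sup>2 \<le> d"
  proof (rule tendsto_le[OF _ _ tendsto_power[OF tendsto_norm[OF tendsto_diff[OF tendsto_const p]]]])
    show "(\<lambda>m. d + inverse (real (Suc m))) \<longlonglongrightarrow> d"
      using tendsto_add[OF tendsto_const[of d] LIMSEQ_inverse_real_of_nat] by simp
  qed (use s(2) in \<open>auto intro!: always_eventually less_imp_le\<close>)
  have re: "(x - p) \<bullet> y = 0" if "y \<in> S" for y
  proof (cases "y = 0")
    case False
    \<comment> \<open>This \<open>t\<close> minimizes the quadratic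
      \<open>(norm (x - p - t *\<^sub>R y))\<^sup>2\<close>.\<close>
    define t where "t = ((x - p) \<bullet> y) / (norm y)\<^sup>2"
    have "(norm (x - p))\<^sup>2 \<le> (norm (x - p - t *\<^sub>R y))\<^sup>2"
      unfolding diff_diff_add using min d[of "p + t *\<^sub>R y"] add \<open>p \<in> S\<close> scR[OF that]
      by (meson order_trans)
    then have "((x - p) \<bullet> y)\<^sup>2 / (norm y)\<^sup>2 \<le> 0"
      unfolding norm_diff_scaleR t_def using False by (simp add: power2_eq_square field_simps)
    then show ?thesis
      using False by (simp add: divide_le_0_iff)
  qed simp
  have "cinner (x - p) y = 0" if "y \<in> S" for y
  proof -
    \<comment> \<open>Testing against \<open>\<i> *\<^sub>C y\<close> turns the imaginary part into
      a real part.\<close>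
    have "Re (cinner (x - p) (\<i> *\<^sub>C y)) = 0"
      using re[of "\<i> *\<^sub>C y"] add that by (simp add: inner_cinner)
    then show ?thesis
      using re[OF that] by (simp add: complex_eq_iff inner_cinner cinner_scaleC_right)
  qed
  with \<open>p \<in> S\<close> show thesis
    by (rule that)
qed

lemma proj_eqI:
  assumes S: "closed_csubspace S" and p: "p \<in> S" "\<And>y. y \<in> S \<Longrightarrow> cinner (x - p) y = 0"
  shows "proj S x = p"
  unfolding proj_def
proof (rule the_equality)
  fix q
  assume q: "q \<in> S \<and> (\<forall>y\<in>S. cinner (x - q) y = 0)"
  then have "p - q \<in> S"
    using S p closed_csubspace_diff by blast
  then have "cinner (x - q) (p - q) - cinner (x - p) (p - q) = 0"
    using q p by simp
  then have "cinner (p - q) (p - q) = 0"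
    by (simp add: cinner_diff_left)
  then show "q = p"
    by simp
qed (use p in blast)

lemma
  assumes S: "closed_csubspace S"
  shows proj_in: "proj S x \<in> S"
    and cinner_proj: "y \<in> S \<Longrightarrow> cinner (x - proj S x) y = 0"
proof -
  obtain p where p: "p \<in> S" "\<And>y. y \<in> S \<Longrightarrow> cinner (x - p) y = 0"
    using projection_exists[OF S] by blast
  have "proj S x = p"
    by (rule proj_eqI[OF S]) (use p in auto)
  with p show "proj S x \<in> S" "y \<in> S \<Longrightarrow> cinner (x - proj S x) y = 0"
    by simp_all
qed

lemma proj_ident: "closed_csubspace S \<Longrightarrow> x \<in> S \<Longrightarrow> proj S x = x"
  by (rule proj_eqI) auto

section \<open>Bounded complex-linear maps\<close>

definition bounded_clinear :: "('a::complex_hilbert_space \<Rightarrow> 'b::complex_hilbert_space) \<Rightarrow> bool" where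
  "bounded_clinear T \<longleftrightarrow> bounded_linear T \<and> (\<forall>c x. T (c *\<^sub>C x) = c *\<^sub>C T x)"

lemma bounded_clinear_add: "bounded_clinear T \<Longrightarrow> T (x + y) = T x + T y"
  by (simp add: bounded_clinear_def linear_simps)

lemma bounded_clinear_diff: "bounded_clinear T \<Longrightarrow> T (x - y) = T x - T y"
  by (simp add: bounded_clinear_def linear_simps)

lemma bounded_clinear_scaleC: "bounded_clinear T \<Longrightarrow> T (c *\<^sub>C x) = c *\<^sub>C T x"
  by (simp add: bounded_clinear_def)

lemma bounded_clinear_zero: "bounded_clinear T \<Longrightarrow> T 0 = 0"
  by (simp add: bounded_clinear_def linear_simps)

lemma bounded_clinear_sum: "bounded_clinear T \<Longrightarrow> T (sum f A) = (\<Sum>k\<in>A. T (f k))"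
  using linear_sum[OF bounded_linear.linear] by (auto simp: bounded_clinear_def)

lemma bounded_clinear_continuous: "bounded_clinear T \<Longrightarrow> continuous_on A T"
  by (simp add: bounded_clinear_def linear_continuous_on)

lemmas bounded_clinear_simps =
  bounded_clinear_add bounded_clinear_diff bounded_clinear_scaleC bounded_clinear_zero

lemma bounded_clinearI:
  assumes "clinear_on UNIV T" "\<And>x. norm (T x) \<le> norm x * K"
  shows "bounded_clinear T"
  using assms unfolding bounded_clinear_def clinear_on_def
  by (auto intro!: bounded_linear_intro[where K = K] simp: scaleR_scaleC)

lemma bounded_clinear_ident: "bounded_clinear (\<lambda>x. x)"
  by (simp add: bounded_clinear_def)

lemma bounded_clinear_compose:
  "bounded_clinear S \<Longrightarrow> bounded_clinear T \<Longrightarrow> bounded_clinear (\<lambda>x. S (T x))"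
  by (auto simp: bounded_clinear_def intro: bounded_linear_compose)

lemma bounded_clinear_plus:
  "bounded_clinear S \<Longrightarrow> bounded_clinear T \<Longrightarrow> bounded_clinear (\<lambda>x. S x + T x)"
  by (auto simp: bounded_clinear_def scaleC_add_right intro: bounded_linear_add)

lemma bounded_clinear_minus:
  "bounded_clinear S \<Longrightarrow> bounded_clinear T \<Longrightarrow> bounded_clinear (\<lambda>x. S x - T x)"
  by (auto simp: bounded_clinear_def scaleC_diff_right intro: bounded_linear_sub)

lemma closed_csubspace_kernel:
  assumes "bounded_clinear T"
  shows "closed_csubspace {x. T x = 0}"
  using closed_Collect_eq[OF bounded_clinear_continuous[OF assms] continuous_on_const, of 0]
  by (simp add: closed_csubspace_def bounded_clinear_simps[OF assms])

lemma closed_csubspace_Int: "closed_csubspace S \<Longrightarrow> closed_csubspace T \<Longrightarrow> closed_csubspace (S \<inter> T)"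
  by (auto simp: closed_csubspace_def)

lemma bounded_clinear_proj:
  assumes S: "closed_csubspace S"
  shows "bounded_clinear (proj S)"
proof (rule bounded_clinearI[where K = 1])
  note sub = S[unfolded closed_csubspace_def] and P = proj_in[OF S] cinner_proj[OF S]
  have "proj S (x + y) = proj S x + proj S y" for x y
  proof (rule proj_eqI[OF S])
    fix z assume "z \<in> S"
    then show "cinner (x + y - (proj S x + proj S y)) z = 0"
      using P(2)[of z x] P(2)[of z y] by (simp add: cinner_diff_left cinner_add_left)
  qed (use sub P(1) in blast)
  moreover have "proj S (c *\<^sub>C x) = c *\<^sub>C proj S x" for c x
  proof (rule proj_eqI[OF S])
    fix z assume "z \<in> S"
    then show "cinner (c *\<^sub>C x - c *\<^sub>C proj S x) z = 0"
      using P(2)[of z x] by (simp add: cinner_diff_left cinner_scaleC_left)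
  qed (use sub P(1) in blast)
  ultimately show "clinear_on UNIV (proj S)"
    by (simp add: clinear_on_def)
  fix x
  have "(norm (x - proj S x + proj S x))\<^sup>2 = (norm (x - proj S x))\<^sup>2 + (norm (proj S x))\<^sup>2"
    by (rule norm_add_orthogonal[OF P(2)[OF P(1)]])
  then have "(norm (proj S x))\<^sup>2 \<le> (norm x)\<^sup>2"
    by simp
  from power2_le_imp_le[OF this] show "norm (proj S x) \<le> norm x * 1"
    by simp
qed

lemma cinner_proj_self:
  assumes "closed_csubspace S"
  shows "cinner (proj S x) x = cinner (proj S x) (proj S x)"
proof -
  have "cinner (proj S x) (x - proj S x) = 0"
    using cinner_proj[OF assms proj_in[OF assms], of x x] by (simp add: cinner_eq_0_commute)
  then show ?thesis
    by (simp add: cinner_diff_right)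
qed

section \<open>Isometries and their adjoints\<close>

lemma isometry_on_cinner:
  assumes S: "closed_csubspace S" and A: "isometry_on S T A" and x: "x \<in> S" "y \<in> S"
  shows "cinner (A x) (A y) = cinner x y"
proof -
  note sub = S[unfolded closed_csubspace_def] and iso = A[unfolded isometry_on_def clinear_on_def]
  have inn: "A u \<bullet> A v = u \<bullet> v" if "u \<in> S" "v \<in> S" for u v
  proof -
    have "norm (A (u + v)) = norm (u + v)" "A (u + v) = A u + A v" "norm (A u) = norm u" "norm (A v) = norm v"
      using iso sub that by blast+
    then show ?thesis
      unfolding dot_norm by simp
  qed
  have "Re (cinner (A (\<i> *\<^sub>C x)) (A y)) = Re (cinner (\<i> *\<^sub>C x) y)"
    using inn[of "\<i> *\<^sub>C x" y] x sub unfolding inner_cinner by blast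
  then show ?thesis
    using inn[OF x] conjunct1[OF iso] x(1) by (simp add: complex_eq_iff inner_cinner cinner_scaleC_left)
qed

lemma isometry_on_inj:
  assumes S: "closed_csubspace S" and A: "isometry_on S T A" and x: "x \<in> S" "y \<in> S" "A x = A y"
  shows "x = y"
proof -
  have d: "x - y \<in> S"
    by (rule closed_csubspace_diff[OF S x(1,2)])
  have "cinner (A x) (A (x - y)) - cinner (A y) (A (x - y)) = 0"
    by (simp add: x(3))
  then have "cinner (x - y) (x - y) = 0"
    by (simp add: isometry_on_cinner[OF S A x(1) d] isometry_on_cinner[OF S A x(2) d] cinner_diff_left)
  then show ?thesis
    by simp
qed

text \<open>\<open>x\<close> itself satisfies the relation defining the adjoint at
  \<open>A x\<close>, so no existence theorem for adjoints is involved. For unitary \<open>A\<close>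
  such points exhaust \<open>S\<close>.\<close>

lemma adjoint_on_unitary:
  assumes S: "closed_csubspace S" and A: "isometry_on S S A" and x: "x \<in> S"
  shows "adjoint_on S A (A x) = x"
  unfolding adjoint_on_def
proof (rule the_equality)
  show "x \<in> S \<and> (\<forall>y\<in>S. cinner (A y) (A x) = cinner y x)"
    using x isometry_on_cinner[OF S A] by simp
  fix w
  assume w: "w \<in> S \<and> (\<forall>y\<in>S. cinner (A y) (A x) = cinner y w)"
  have d: "w - x \<in> S"
    using S w x by (simp add: closed_csubspace_diff)
  have "cinner (A (w - x)) (A x) = cinner (w - x) w"
    using w d by blast
  then have "cinner (w - x) (w - x) = 0"
    by (simp add: isometry_on_cinner[OF S A d x] cinner_diff_right)
  then show "w = x"
    by simp
qed

abbreviation isometry :: "('a::complex_hilbert_space \<Rightarrow> 'b::complex_hilbert_space) \<Rightarrow> bool" where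
  "isometry \<equiv> isometry_on UNIV UNIV"

abbreviation adj :: "('a::complex_hilbert_space \<Rightarrow> 'a) \<Rightarrow> 'a \<Rightarrow> 'a" where
  "adj \<equiv> adjoint_on UNIV"

lemma isometry_norm: "isometry A \<Longrightarrow> norm (A x) = norm x"
  by (simp add: isometry_on_def)

lemmas isometry_cinner = isometry_on_cinner[OF closed_csubspace_UNIV _ UNIV_I UNIV_I]

lemma isometry_bounded_clinear: "isometry A \<Longrightarrow> bounded_clinear A"
  by (auto simp: isometry_on_def intro: bounded_clinearI[where K = 1])

lemma isometry_compose: "isometry A \<Longrightarrow> isometry B \<Longrightarrow> isometry (A \<circ> B)"
  by (simp add: isometry_on_def clinear_on_def)

lemma isometry_id: "isometry id"
  by (simp add: isometry_on_def clinear_on_def)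

lemma adj_eqI: "(\<And>x. cinner (A x) y = cinner x w) \<Longrightarrow> adj A y = w"
  unfolding adjoint_on_def by (rule the_equality) (auto intro: cinner_eqI)

text \<open>Distances are preserved, so a Cauchy sequence in the range pulls back to a Cauchy
  sequence, and completeness of the domain provides the limit.\<close>

lemma closed_csubspace_range_isometry:
  assumes A: "isometry A"
  shows "closed_csubspace (range A)"
proof -
  note lin = bounded_clinear_simps[OF isometry_bounded_clinear[OF A]]
  have "closed (range A)"
  proof (rule complete_imp_closed, rule completeI)
    fix f
    assume f: "\<forall>n. f n \<in> range A" and "Cauchy f"
    define g where "g n = inv A (f n)" for n
    have g: "f n = A (g n)" for n
      using f by (simp add: g_def f_inv_into_f)
    have "dist (f m) (f n) = dist (g m) (g n)" for m n
      by (simp add: g dist_norm lin(2)[symmetric] isometry_norm[OF A])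
    then have "Cauchy g"
      using \<open>Cauchy f\<close> by (simp add: Cauchy_def)
    then obtain l where "g \<longlonglongrightarrow> l"
      using Cauchy_convergent convergent_def by blast
    then have "(\<lambda>n. A (g n)) \<longlonglongrightarrow> A l"
      by (rule bounded_linear.tendsto[OF conjunct1[OF isometry_bounded_clinear[OF A, unfolded bounded_clinear_def]]])
    then have "f \<longlonglongrightarrow> A l"
      by (simp add: g[symmetric])
    then show "\<exists>l\<in>range A. f \<longlonglongrightarrow> l"
      by blast
  qed
  then show ?thesis
    using rangeI[of A 0] by (auto simp: closed_csubspace_def lin(4) simp flip: lin(1,3))
qed

text \<open>The projection of \<open>y\<close> onto the closed range of \<open>A\<close> has the
  form \<open>A w\<close>. The remainder is orthogonal to the range, so \<open>w\<close> is the
  value of the adjoint at \<open>y\<close>.\<close>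

lemma isometry_adj:
  assumes A: "isometry A"
  shows "cinner (A x) y = cinner x (adj A y)"
proof -
  let ?R = "range A"
  note R = closed_csubspace_range_isometry[OF A]
  obtain w where w: "proj ?R y = A w"
    using proj_in[OF R] by auto
  have eq: "cinner (A x) y = cinner x w" for x
  proof -
    have "cinner (A x) (y - A w) = 0"
      using cinner_proj[OF R, of "A x" y] w cinner_eq_0_commute by auto
    then show ?thesis
      by (simp add: cinner_diff_right isometry_cinner[OF A])
  qed
  show ?thesis
    using adj_eqI[OF eq] eq by simp
qed

lemma isometry_adj_left: "isometry A \<Longrightarrow> cinner (adj A x) y = cinner x (A y)"
  by (metis cinner_commute isometry_adj)

lemma adj_isometry: "isometry A \<Longrightarrow> adj A (A x) = x"
  by (rule adj_eqI) (rule isometry_cinner)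

lemma adj_id [simp]: "adj id x = x"
  using adj_isometry[OF isometry_id, of x] by simp

lemma adj_compose: "isometry A \<Longrightarrow> isometry B \<Longrightarrow> adj (A \<circ> B) x = adj B (adj A x)"
  by (rule adj_eqI) (simp add: isometry_adj)

lemma bounded_clinear_adj:
  assumes A: "isometry A"
  shows "bounded_clinear (adj A)"
proof (rule bounded_clinearI[where K = 1])
  show "clinear_on UNIV (adj A)"
    unfolding clinear_on_def
    by (intro conjI ballI allI; rule adj_eqI)
      (simp_all add: cinner_add_right cinner_scaleC_right isometry_adj[OF A, symmetric])
  fix x
  have "cinner (A (adj A x)) x = complex_of_real ((norm (adj A x))\<^sup>2)"
    by (simp add: isometry_adj[OF A] cinner_self)
  then have "(norm (adj A x))\<^sup>2 \<le> norm (adj A x) * norm x"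
    using cmod_cinner_le[of "A (adj A x)" x] by (simp add: isometry_norm[OF A] norm_power)
  then show "norm (adj A x) \<le> norm x * 1"
    by (cases "norm (adj A x) = 0") (simp_all add: power2_eq_square)
qed

lemma closed_csubspace_kernel_adj: "isometry A \<Longrightarrow> closed_csubspace {x. adj A x = 0}"
  by (simp add: bounded_clinear_adj closed_csubspace_kernel)

text \<open>\<open>A (adj A x)\<close> is the component of \<open>x\<close> in the range of
  \<open>A\<close>, and the rest lies in the kernel of \<open>adj A\<close>. Projections onto such
  kernels thereby become expressions in \<open>A\<close> and \<open>adj A\<close>.\<close>

lemma proj_kernel_adj:
  assumes A: "isometry A"
  shows "proj {x. adj A x = 0} x = x - A (adj A x)"
  by (rule proj_eqI[OF closed_csubspace_kernel_adj[OF A]])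
     (simp_all add: bounded_clinear_diff[OF bounded_clinear_adj[OF A]] adj_isometry[OF A] isometry_adj[OF A])

section \<open>Products of operators and of unitaries on a subspace\<close>

lemma op_prod_Nil [simp]: "op_prod A [] = id"
  by (simp add: op_prod_def)

lemma op_prod_Cons [simp]: "op_prod A (j # js) = A j \<circ> op_prod A js"
  by (simp add: op_prod_def)

lemma op_prod_append: "op_prod A (js @ ks) = op_prod A js \<circ> op_prod A ks"
  by (induction js) auto

lemma op_prod_permute:
  fixes A :: "nat \<Rightarrow> 'a \<Rightarrow> 'a"
  assumes "\<And>i j. i \<in> set js \<Longrightarrow> j \<in> set js \<Longrightarrow> A i \<circ> A j = A j \<circ> A i" "mset js = mset ks"
  shows "op_prod A js = op_prod A ks"
proof -
  \<comment> \<open>\<open>foldr\<close> over a list is \<open>fold\<close> over its reverse, and a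
    \<open>fold\<close> of commuting steps depends only on the multiset of entries.\<close>
  have "fold (\<lambda>j B :: 'a \<Rightarrow> 'a. A j \<circ> B) (rev js) = fold (\<lambda>j B. A j \<circ> B) (rev ks)"
  proof (rule fold_multiset_equiv)
    fix i j
    assume "i \<in> set (rev js)" "j \<in> set (rev js)"
    then have "A i \<circ> A j = A j \<circ> A i"
      using assms(1) by simp
    then show "(\<circ>) (A i) \<circ> (\<circ>) (A j) = (\<circ>) (A j) \<circ> (\<circ>) (A i)"
      by (simp add: fun_eq_iff)
  qed (use assms(2) in simp)
  then show ?thesis
    by (simp add: op_prod_def foldr_conv_fold)
qed

lemma rev_upt_Suc: "0 < k \<Longrightarrow> rev [Suc 0..<Suc k] = k # rev [Suc 0..<k]"
  by simp

lemma isometry_op_prod: "(\<And>j. j \<in> set js \<Longrightarrow> isometry (A j)) \<Longrightarrow> isometry (op_prod A js)"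
  by (induction js) (auto intro: isometry_compose simp: isometry_id)

lemma isometry_on_id: "isometry_on E E id"
  by (simp add: isometry_on_def clinear_on_def)

lemma isometry_on_compose:
  "isometry_on S T A \<Longrightarrow> isometry_on R S B \<Longrightarrow> isometry_on R T (A \<circ> B)"
  by (auto simp: isometry_on_def clinear_on_def image_subset_iff)

lemma isometry_on_op_prod:
  "(\<And>j. j \<in> set js \<Longrightarrow> unitary_on E E (U j)) \<Longrightarrow> isometry_on E E (op_prod U js)"
  by (induction js) (auto intro: isometry_on_compose isometry_on_id simp: unitary_on_def)

lemma isometry_on_in: "isometry_on S T A \<Longrightarrow> x \<in> S \<Longrightarrow> A x \<in> T"
  by (auto simp: isometry_on_def)

lemma isometry_on_add: "isometry_on S T A \<Longrightarrow> x \<in> S \<Longrightarrow> y \<in> S \<Longrightarrow> A (x + y) = A x + A y"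
  by (simp add: isometry_on_def clinear_on_def)

lemma isometry_on_scaleC: "isometry_on S T A \<Longrightarrow> x \<in> S \<Longrightarrow> A (c *\<^sub>C x) = c *\<^sub>C A x"
  by (simp add: isometry_on_def clinear_on_def)

lemma isometry_on_diff:
  assumes "closed_csubspace S" "isometry_on S T A" "x \<in> S" "y \<in> S"
  shows "A (x - y) = A x - A y"
  using isometry_on_add[OF assms(2) closed_csubspace_diff[OF assms(1,3,4)] assms(4)]
  by (simp add: eq_diff_eq)

lemma
  assumes E: "closed_csubspace E" and U: "unitary_on E E U" and x: "x \<in> E"
  shows adjoint_on_unitary_in: "adjoint_on E U x \<in> E"
    and unitary_adjoint_on: "U (adjoint_on E U x) = x"
proof -
  have iso: "isometry_on E E U"
    using U by (simp add: unitary_on_def)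
  obtain y where y: "y \<in> E" "x = U y"
    using U x by (auto simp: unitary_on_def)
  show "adjoint_on E U x \<in> E" "U (adjoint_on E U x) = x"
    using y adjoint_on_unitary[OF E iso y(1)] by simp_all
qed

text \<open>The adjoint of a unitary is its inverse, and inverting a product reverses its factors;
  hence \<open>rev js\<close>.\<close>

lemma
  assumes E: "closed_csubspace E" and U: "\<And>j. j \<in> set js \<Longrightarrow> unitary_on E E (U j)" and x: "x \<in> E"
  shows op_prod_adjoint_on_in: "op_prod (\<lambda>j. adjoint_on E (U j)) js x \<in> E"
    and op_prod_adjoint_on: "op_prod U (rev js) (op_prod (\<lambda>j. adjoint_on E (U j)) js x) = x"
proof -
  have "op_prod (\<lambda>j. adjoint_on E (U j)) js x \<in> E \<and>
    op_prod U (rev js) (op_prod (\<lambda>j. adjoint_on E (U j)) js x) = x"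
    using U
  proof (induction js)
    case (Cons j js)
    then show ?case
      by (simp add: op_prod_append adjoint_on_unitary_in[OF E] unitary_adjoint_on[OF E])
  qed (simp add: x)
  then show "op_prod (\<lambda>j. adjoint_on E (U j)) js x \<in> E"
    "op_prod U (rev js) (op_prod (\<lambda>j. adjoint_on E (U j)) js x) = x"
    by auto
qed

section \<open>Factorizations of an isometry\<close>

text \<open>
  In the functional model, \<open>w\<close> is the value at 1 of the polynomial \<open>h\<close>; this turns identities between
  products of the \<open>V\<^sub>i\<close> into identities between products of the \<open>U\<^sub>i\<close>.
\<close>

inductive wold_sum :: "('a::complex_hilbert_space \<Rightarrow> 'a) \<Rightarrow> 'a \<Rightarrow> 'a \<Rightarrow> bool" for S where
  zero: "wold_sum S 0 0"
| step: "adj S x = 0 \<Longrightarrow> wold_sum S h w \<Longrightarrow> wold_sum S (x + S h) (x + w)"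

text \<open>\<open>adj S\<close> kills \<open>x\<close> and undoes \<open>S\<close>, so it recovers
  \<open>h\<close>, and then \<open>x\<close>.\<close>

lemma wold_eq_iff:
  assumes S: "isometry S" and x: "adj S x = 0" "adj S y = 0"
  shows "x + S h = y + S k \<longleftrightarrow> x = y \<and> h = k"
proof -
  have "adj S (x + S h) = h" "adj S (y + S k) = k"
    by (simp_all add: bounded_clinear_add[OF bounded_clinear_adj[OF S]] adj_isometry[OF S] x)
  then show ?thesis
    by (metis add_right_cancel)
qed

text \<open>Two derivations for the same \<open>h\<close> may differ in length; this shows that the
  surplus summands contribute nothing to \<open>w\<close>.\<close>

lemma wold_sum_zero:
  assumes S: "isometry S"
  shows "wold_sum S h w \<Longrightarrow> h = 0 \<Longrightarrow> w = 0"
proof (induction rule: wold_sum.induct)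
  case (step x h w)
  then show ?case
    using wold_eq_iff[OF S, of x 0 h 0]
    by (simp add: bounded_clinear_zero isometry_bounded_clinear[OF S] bounded_clinear_adj[OF S])
qed simp

text \<open>The coefficients of \<open>h\<close> are compared one by one with
  \<open>wold_eq_iff\<close>, so \<open>w\<close> is a function of \<open>h\<close>.\<close>

lemma wold_sum_unique:
  assumes S: "isometry S"
  shows "wold_sum S h w \<Longrightarrow> wold_sum S h w' \<Longrightarrow> w = w'"
proof (induction arbitrary: w' rule: wold_sum.induct)
  case zero
  then show ?case
    using wold_sum_zero[OF S] by auto
next
  case (step x h w)
  from step.prems show ?case
  proof cases
    case zero
    then show ?thesis
      using wold_sum_zero[OF S wold_sum.step[OF step.hyps]] by simp
  next
    case (step y k v)
    then show ?thesis
      using wold_eq_iff[OF S \<open>adj S x = 0\<close>, of y h k] \<open>\<And>w'. wold_sum S h w' \<Longrightarrow> w = w'\<close> by auto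
  qed
qed

lemma wold_sum_add_kernel:
  assumes S: "isometry S" and y: "adj S y = 0"
  shows "wold_sum S h w \<Longrightarrow> wold_sum S (y + h) (y + w)"
proof (induction rule: wold_sum.cases)
  case zero
  then show ?case
    using wold_sum.step[OF y wold_sum.zero] by (simp add: bounded_clinear_zero isometry_bounded_clinear[OF S])
next
  case (step x k v)
  then show ?case
    using wold_sum.step[of S "y + x" k v]
    by (simp add: bounded_clinear_add[OF bounded_clinear_adj[OF S]] y add.assoc)
qed

lemma wold_sum_kernel: "isometry S \<Longrightarrow> adj S x = 0 \<Longrightarrow> wold_sum S x x"
  using wold_sum_add_kernel[OF _ _ wold_sum.zero] by fastforce

text \<open>Multiplication by the variable does not change the value at 1.\<close>

lemma wold_sum_shift: "isometry S \<Longrightarrow> wold_sum S h w \<Longrightarrow> wold_sum S (S h) w"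
  using wold_sum.step[of S 0 h w] by (simp add: bounded_clinear_zero bounded_clinear_adj)

text \<open>\<open>A\<close> stands for one factor \<open>V\<^sub>i\<close> of the product
  \<open>S\<close>, and \<open>B\<close> for the product of the others. What concerns a single index
  is derived here, without convergence of the powers of \<open>adj S\<close>.\<close>

locale isometry_factorization =
  fixes A B S U Q :: "'a::complex_hilbert_space \<Rightarrow> 'a" and W :: "'a set"
  assumes A: "isometry A" and B: "isometry B"
    and S_eq: "A \<circ> B = S" and commute: "B \<circ> A = S"
    and W_def: "W = {x. adj S x = 0}"
    and U_def: "\<And>x. U x = proj W (A x) + adj B x"
    and Q_def: "\<And>x. Q x = x - proj {x. adj B x = 0} x"
begin

lemma S: "isometry S"
  using isometry_compose[OF A B] by (simp add: S_eq)

lemma BA: "B (A x) = A (B x)" "S x = A (B x)"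
  using S_eq commute by (metis comp_apply)+

lemma adj_S: "adj S x = adj B (adj A x)" "adj A (adj B x) = adj B (adj A x)"
  using adj_compose[OF A B, of x] adj_compose[OF B A, of x] by (simp_all add: S_eq commute)

lemma W_iff: "x \<in> W \<longleftrightarrow> adj B (adj A x) = 0"
  by (simp add: W_def adj_S)

lemma W: "closed_csubspace W"
  by (simp add: W_def closed_csubspace_kernel_adj S)

lemmas lin =
  bounded_clinear_simps[OF isometry_bounded_clinear[OF A]] bounded_clinear_simps[OF isometry_bounded_clinear[OF B]]
  bounded_clinear_simps[OF bounded_clinear_adj[OF A]] bounded_clinear_simps[OF bounded_clinear_adj[OF B]]
  adj_isometry[OF A] adj_isometry[OF B]

lemma Q_eq: "Q x = B (adj B x)"
  by (simp add: Q_def proj_kernel_adj B)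

text \<open>The projection onto \<open>W\<close> subtracts \<open>S (adj S (A x))\<close>, which is
  \<open>A (B (adj B x))\<close> since \<open>adj A\<close> cancels \<open>A\<close>. The formula
  makes sense on the whole space and no longer mentions \<open>W\<close>.\<close>

lemma U_eq: "U x = A x - A (B (adj B x)) + adj B x"
  unfolding U_def W_def proj_kernel_adj[OF S] by (simp add: adj_S BA lin)

lemma bounded_clinear_U: "bounded_clinear U"
  unfolding ext[of U, OF U_eq]
  by (intro bounded_clinear_plus bounded_clinear_minus bounded_clinear_compose[OF isometry_bounded_clinear[OF A]]
      bounded_clinear_compose[OF isometry_bounded_clinear[OF B]] bounded_clinear_adj B isometry_bounded_clinear A)

lemma bounded_clinear_Q: "bounded_clinear Q"
  unfolding ext[of Q, OF Q_eq]
  by (intro bounded_clinear_compose[OF isometry_bounded_clinear[OF B]] bounded_clinear_adj B)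

lemma Q_in: "x \<in> W \<Longrightarrow> Q x \<in> W"
  by (simp add: W_iff Q_eq lin adj_S(2)[symmetric])

lemma U_in: "x \<in> W \<Longrightarrow> U x \<in> W"
  by (simp add: W_iff U_eq lin adj_S(2)[symmetric])

lemma U_Q: "U (Q x) = adj B x"
  by (simp add: U_eq Q_eq lin)

text \<open>The two summands are \<open>A (x - Q x)\<close> and \<open>A (Q x)\<close>. For
  \<open>x\<close> in \<open>W\<close> both \<open>U (x - Q x)\<close> and \<open>U (Q x)\<close>
  lie in \<open>W\<close>, so this is then the Wold expansion of \<open>A x\<close>.\<close>

lemma A_eq: "A x = U (x - Q x) + S (U (Q x))"
  unfolding bounded_clinear_diff[OF bounded_clinear_U] U_Q by (simp add: U_eq BA)

lemma unitary_U: "unitary_on W W U"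
  unfolding unitary_on_def isometry_on_def
proof (intro conjI ballI equalityI subsetI)
  show "clinear_on W U"
    by (simp add: clinear_on_def bounded_clinear_simps[OF bounded_clinear_U])
  fix x
  assume x: "x \<in> W"
  let ?b = "adj B x"
  \<comment> \<open>\<open>adj A ?b\<close> is \<open>adj S x\<close>, which vanishes on
    \<open>W\<close>; so \<open>U x\<close> is an orthogonal sum of \<open>A (x - B ?b)\<close> and
    \<open>?b\<close>.\<close>
  have "cinner (A (x - B ?b)) ?b = 0"
    using x by (simp add: isometry_adj[OF A] W_iff adj_S(2))
  from norm_add_orthogonal[OF this]
  have "(norm (U x))\<^sup>2 = (norm (x - B ?b))\<^sup>2 + (norm (B ?b))\<^sup>2"
    by (simp add: U_eq lin isometry_norm[OF B]) (simp add: lin(2)[symmetric] isometry_norm[OF A])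
  moreover have "cinner (x - B ?b) (B ?b) = 0"
    by (simp add: isometry_adj_left[OF B, symmetric] lin)
  from norm_add_orthogonal[OF this]
  have "(norm x)\<^sup>2 = (norm (x - B ?b))\<^sup>2 + (norm (B ?b))\<^sup>2"
    by simp
  ultimately have "(norm (U x))\<^sup>2 = (norm x)\<^sup>2"
    by simp
  then show "norm (U x) = norm x"
    by simp
next
  fix u
  assume u: "u \<in> W"
  \<comment> \<open>The inverse of \<open>U\<close> is the same operator with \<open>A\<close> and
    \<open>B\<close> exchanged.\<close>
  let ?w = "adj A u + B u - A (B (adj A u))"
  have w: "adj B ?w = u - A (adj A u)"
    using u by (simp add: lin W_iff BA(1)[symmetric])
  have "U ?w = u"
    unfolding U_eq w by (simp add: lin BA)
  moreover have "?w \<in> W"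
    using u unfolding W_iff adj_S(2)[symmetric] w by (simp add: lin)
  ultimately show "u \<in> U ` W"
    by (rule image_eqI[OF sym])
qed (use U_in in auto)

lemma projection_Q: "projection_on W Q"
  unfolding projection_on_def
proof (intro exI conjI ballI)
  \<comment> \<open>The range of \<open>Q\<close> on \<open>W\<close>, written as a kernel to make
    it visibly closed.\<close>
  let ?R = "W \<inter> {x. x - Q x = 0}"
  show R: "closed_csubspace ?R"
    by (intro closed_csubspace_Int W closed_csubspace_kernel bounded_clinear_minus bounded_clinear_ident
        bounded_clinear_Q)
  fix x
  assume x: "x \<in> W"
  have "proj ?R x = Q x"
  proof (rule proj_eqI[OF R])
    show "Q x \<in> ?R"
      using Q_in[OF x] by (simp add: Q_eq lin)
    fix y
    assume "y \<in> ?R"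
    then have "y = B (adj B y)"
      by (simp add: Q_eq)
    then have "cinner (x - Q x) y = cinner (adj B (x - Q x)) (adj B y)"
      by (metis isometry_adj_left[OF B])
    then show "cinner (x - Q x) y = 0"
      by (simp add: Q_eq lin)
  qed
  then show "Q x = proj ?R x"
    by simp
qed blast

text \<open>The symbol \<open>U (x - Q x + z *\<^sub>C Q x)\<close> of \<open>A\<close> is
  \<open>U x\<close> at \<open>z = 1\<close>; \<open>A_eq\<close> makes this precise for
  polynomials.\<close>

lemma wold_sum_U: "wold_sum S h w \<Longrightarrow> wold_sum S (A h) (U w)"
proof (induction rule: wold_sum.induct)
  case zero
  then show ?case
    by (simp add: lin bounded_clinear_zero[OF bounded_clinear_U] wold_sum.zero)
next
  case (step x h w)
  then have x: "x \<in> W"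
    by (simp add: W_def)
  then have UQ: "adj S (U (Q x)) = 0" and U_Q': "adj S (U (x - Q x)) = 0"
    using U_in Q_in closed_csubspace_diff[OF W] unfolding W_def by blast+
  \<comment> \<open>The part \<open>U (Q x)\<close> moves one degree up and joins the lowest
    coefficient of \<open>A h\<close>.\<close>
  have "wold_sum S (U (x - Q x) + S (U (Q x) + A h)) (U (x - Q x) + (U (Q x) + U w))"
    by (intro wold_sum.step U_Q' wold_sum_add_kernel S UQ step.IH)
  moreover have "A (x + S h) = U (x - Q x) + S (U (Q x) + A h)"
    using A_eq[of x] by (simp add: lin BA)
  moreover have "U (x + w) = U (x - Q x) + (U (Q x) + U w)"
    by (simp add: bounded_clinear_simps[OF bounded_clinear_U])
  ultimately show ?case
    by simp
qed

text \<open>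
  \<open>U\<close> maps the kernel of \<open>D\<^sup>*\<close> as \<open>A\<close> does, and the range of \<open>Q\<close> onto the kernel of \<open>A\<^sup>*\<close>; the two images
  are orthogonal and span the kernel of \<open>(A D)\<^sup>*\<close>.
\<close>

lemma U_proj_kernel:
  assumes D: "isometry D" and C: "isometry C" and DC: "D \<circ> C = B" and y: "y \<in> W"
  shows "U (proj {x. adj D x = 0} y) + U (Q y) = proj {x. adj (A \<circ> D) x = 0} (U y)"
proof -
  note linD = bounded_clinear_simps[OF isometry_bounded_clinear[OF D]] adj_isometry[OF D]
    bounded_clinear_simps[OF bounded_clinear_adj[OF D]]
  have B_eq: "B x = D (C x)" for x
    by (simp add: DC[symmetric])
  have adj_B: "adj B x = adj C (adj D x)" for x
    using adj_compose[OF D C, of x] by (simp add: DC)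
  let ?b = "adj B y"
  \<comment> \<open>The kernel of \<open>adj D\<close> lies in that of \<open>adj B\<close>, where
    \<open>U\<close> acts as \<open>A\<close>.\<close>
  have "adj B (y - D (adj D y)) = 0"
    by (simp add: adj_B linD bounded_clinear_simps[OF bounded_clinear_adj[OF C]])
  then have l: "U (proj {x. adj D x = 0} y) = A y - A (D (adj D y))"
    by (simp add: proj_kernel_adj[OF D] U_eq lin)
  have "adj A ?b = 0"
    using y by (simp add: W_iff adj_S(2))
  then have "adj (A \<circ> D) (U y) = adj D y - C ?b"
    by (simp add: adj_compose[OF A D] U_eq lin) (simp add: B_eq linD)
  then show ?thesis
    by (simp add: proj_kernel_adj[OF isometry_compose[OF A D]] l U_Q lin linD)
       (simp add: U_eq B_eq)
qed

end

lemma mset_Cons_filter_neq: "distinct xs \<Longrightarrow> i \<in> set xs \<Longrightarrow> mset (i # filter (\<lambda>j. j \<noteq> i) xs) = mset xs"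
proof (induction xs)
  case (Cons x xs)
  then show ?case
    by (cases "x = i") (auto simp del: mset_filter intro!: arg_cong[of _ _ mset] filter_True)
qed simp

lemma proj_kernel_id: "proj {x. adj id x = 0} x = 0"
  using proj_kernel_adj[OF isometry_id, of x] by simp

section \<open>The tuple of unitaries and projections of an \<open>n\<close>-isometry\<close>

locale isometry_tuple =
  fixes n :: nat and V C U Q :: "nat \<Rightarrow> 'a::complex_hilbert_space \<Rightarrow> 'a" and W :: "'a set"
  assumes n_isometry: "n_isometry n V"
    and W_def: "W = {x. adj (op_prod V [1..<Suc n]) x = 0}"
    and C_def: "\<And>i. C i = op_prod V (filter (\<lambda>j. j \<noteq> i) [1..<Suc n])"
    and U_def: "\<And>i x. U i x = proj W (V i x) + adj (C i) x"
    and Q_def: "\<And>i x. Q i x = x - proj {x. adj (C i) x = 0} x"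
begin

declare upt_Suc [simp del]

abbreviation "S \<equiv> op_prod V [1..<Suc n]"

lemma V: "i \<in> {1..n} \<Longrightarrow> isometry (V i)"
  using n_isometry by (simp add: n_isometry_def)

lemma V_commute: "i \<in> {1..n} \<Longrightarrow> j \<in> {1..n} \<Longrightarrow> V i \<circ> V j = V j \<circ> V i"
  using n_isometry by (simp add: n_isometry_def)

lemma op_prod_V_permute: "set js \<subseteq> {1..n} \<Longrightarrow> mset js = mset ks \<Longrightarrow> op_prod V js = op_prod V ks"
  by (rule op_prod_permute) (use V_commute in blast)+

lemma isometry_op_prod_V: "set js \<subseteq> {1..n} \<Longrightarrow> isometry (op_prod V js)"
  by (rule isometry_op_prod) (use V in blast)

lemma factorization:
  assumes i: "i \<in> {1..n}"
  shows "isometry_factorization (V i) (C i) S (U i) (Q i) W"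
proof
  let ?js = "filter (\<lambda>j. j \<noteq> i) [1..<Suc n]"
  have "mset (i # ?js) = mset [1..<Suc n]"
    by (rule mset_Cons_filter_neq) (use i in auto)
  then have "mset (i # ?js) = mset [1..<Suc n]" "mset (?js @ [i]) = mset [1..<Suc n]"
    by (simp_all del: mset_filter)
  then have "op_prod V (i # ?js) = S" "op_prod V (?js @ [i]) = S"
    using i by (intro op_prod_V_permute; auto)+
  then show "V i \<circ> C i = S" "C i \<circ> V i = S"
    by (simp_all add: C_def op_prod_append)
  show "isometry (C i)"
    unfolding C_def by (rule isometry_op_prod_V) auto
qed (rule V[OF i] W_def U_def Q_def)+

lemmas V_eq = isometry_factorization.A_eq[OF factorization]
lemmas U_unitary = isometry_factorization.unitary_U[OF factorization]
lemmas Q_in = isometry_factorization.Q_in[OF factorization]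
lemmas bounded_clinear_U = isometry_factorization.bounded_clinear_U[OF factorization]
lemmas bounded_clinear_Q = isometry_factorization.bounded_clinear_Q[OF factorization]
lemmas U_proj_kernel = isometry_factorization.U_proj_kernel[OF factorization]

lemma U_isometry: "i \<in> {1..n} \<Longrightarrow> isometry_on W W (U i)"
  using U_unitary by (simp add: unitary_on_def)

lemma S: "isometry S"
  by (rule isometry_op_prod_V) auto

lemma W: "closed_csubspace W"
  unfolding W_def by (rule closed_csubspace_kernel_adj[OF S])

lemma add_in_W: "x \<in> W \<Longrightarrow> y \<in> W \<Longrightarrow> x + y \<in> W"
  using W by (simp add: closed_csubspace_def)

lemma wold_sum_op_prod:
  assumes "wold_sum S h w" "set js \<subseteq> {1..n}"
  shows "wold_sum S (op_prod V js h) (op_prod U js w)"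
  using assms(2)
proof (induction js)
  case (Cons j js)
  then show ?case
    using isometry_factorization.wold_sum_U[OF factorization[of j]] by simp
qed (use assms(1) in simp)

text \<open>A vector of \<open>W\<close> is a constant polynomial. Both products of the
  \<open>U i\<close> compute the value at 1 of the same vector, and that value is unique.\<close>

lemma op_prod_U_eq:
  assumes "set js \<subseteq> {1..n}" "set ks \<subseteq> {1..n}" "op_prod V js = op_prod V ks" "x \<in> W"
  shows "op_prod U js x = op_prod U ks x"
proof -
  have "wold_sum S x x"
    using assms(4) wold_sum_kernel[OF S] by (simp add: W_def)
  then show ?thesis
    using wold_sum_unique[OF S] wold_sum_op_prod assms(1-3) by metis
qed

lemma U_commute: "i \<in> {1..n} \<Longrightarrow> j \<in> {1..n} \<Longrightarrow> x \<in> W \<Longrightarrow> U i (U j x) = U j (U i x)"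
  using op_prod_U_eq[of "[i, j]" "[j, i]" x] V_commute by simp

text \<open>The product of the \<open>V i\<close> is \<open>S\<close>, that is, multiplication by
  the variable, which is 1 at the point 1.\<close>

lemma op_prod_U_all:
  assumes x: "x \<in> W"
  shows "op_prod U [1..<Suc n] x = x"
proof -
  have xx: "wold_sum S x x"
    using x wold_sum_kernel[OF S] by (simp add: W_def)
  have "wold_sum S (S x) (op_prod U [1..<Suc n] x)"
    by (rule wold_sum_op_prod[OF xx]) auto
  then show ?thesis
    by (rule wold_sum_unique[OF S wold_sum_shift[OF S xx], symmetric])
qed

text \<open>This brings the sum in the pairwise model condition into a form governed by
  \<open>V j \<circ> V i\<close>, which is symmetric in \<open>i\<close> and \<open>j\<close>.
  \<open>U_proj_kernel\<close> is applied twice, with \<open>id\<close> and with \<open>V i\<close>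
  as \<open>D\<close>.\<close>

lemma U_U_sum_projections:
  assumes ij: "i \<in> {1..n}" "j \<in> {1..n}" "i \<noteq> j" and x: "x \<in> W"
  shows "U j (U i (Q i x + adjoint_on W (U i) (Q j (U i x)))) = proj {x. adj (V j \<circ> V i) x = 0} (U j (U i x))"
proof -
  note Ui = bounded_clinear_simps[OF bounded_clinear_U[OF ij(1)]]
    and Uj = bounded_clinear_simps[OF bounded_clinear_U[OF ij(2)]]
  have y: "U i x \<in> W"
    using isometry_on_in[OF U_isometry] ij x by blast
  have "U i (Q i x) = proj {x. adj (V i) x = 0} (U i x)"
    using U_proj_kernel[OF ij(1) isometry_id _ _ x, of "C i"] isometry_factorization.B[OF factorization[OF ij(1)]]
    unfolding proj_kernel_id by (simp add: Ui)
  moreover have "\<exists>D. isometry D \<and> V i \<circ> D = C j"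
  proof (intro exI conjI)
    \<comment> \<open>The factors other than \<open>i\<close> and \<open>j\<close> complete
      \<open>V i\<close> to \<open>C j\<close>.\<close>
    let ?js = "filter (\<lambda>k. k \<noteq> i) (filter (\<lambda>k. k \<noteq> j) [1..<Suc n])"
    show "isometry (op_prod V ?js)"
      by (rule isometry_op_prod_V) auto
    have "mset (i # ?js) = mset (filter (\<lambda>k. k \<noteq> j) [1..<Suc n])"
      by (rule mset_Cons_filter_neq) (use ij in auto)
    then have "op_prod V (i # ?js) = C j"
      unfolding C_def using ij by (intro op_prod_V_permute) auto
    then show "V i \<circ> op_prod V ?js = C j"
      by simp
  qed
  then obtain D where "isometry D" "V i \<circ> D = C j"
    by blast
  ultimately show ?thesis
    using U_proj_kernel[OF ij(2) V[OF ij(1)], of D "U i x"] y Q_in[OF ij(2) y]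
    by (simp add: Ui Uj unitary_adjoint_on[OF W U_unitary[OF ij(1)]])
qed

text \<open>Both sides have the same image under the injective map \<open>U j \<circ> U i\<close>,
  because \<open>V i\<close> and \<open>V j\<close> commute.\<close>

lemma sum_projections_commute:
  assumes ij: "i \<in> {1..n}" "j \<in> {1..n}" "i \<noteq> j" and x: "x \<in> W"
  shows "Q i x + adjoint_on W (U i) (Q j (U i x)) = Q j x + adjoint_on W (U j) (Q i (U j x))" (is "?l = ?r")
proof -
  note in_W = isometry_on_in[OF U_isometry]
  have l: "?l \<in> W" and r: "?r \<in> W"
    using ij x by (auto intro!: add_in_W Q_in adjoint_on_unitary_in[OF W U_unitary] in_W)
  have "U j (U i ?l) = U i (U j ?r)"
    using U_U_sum_projections[OF ij x] U_U_sum_projections[OF ij(2,1) ij(3)[symmetric] x]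
      V_commute[OF ij(1,2)] U_commute[OF ij(1,2) x] by simp
  then have "U j (U i ?l) = U j (U i ?r)"
    using U_commute[OF ij(1,2) r] by simp
  then show ?thesis
    using isometry_on_inj[OF W U_isometry] l r in_W ij by metis
qed

text \<open>For \<open>D = V j \<circ> V i\<close>, the complement of the sum is carried by
  \<open>U j\<close> and \<open>U i\<close> to \<open>D (adj D u)\<close>, whose inner product with
  \<open>u\<close> is the squared norm of \<open>adj D u\<close>.\<close>

lemma sum_projections_le:
  assumes ij: "i \<in> {1..n}" "j \<in> {1..n}" "i \<noteq> j"
  shows "op_le_on W (\<lambda>x. Q i x + adjoint_on W (U i) (Q j (U i x))) (\<lambda>x. x)"
  unfolding op_le_on_def
proof
  fix x
  assume x: "x \<in> W"
  let ?s = "Q i x + adjoint_on W (U i) (Q j (U i x))" and ?D = "V j \<circ> V i"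
  note in_W = isometry_on_in[OF U_isometry]
  have D: "isometry ?D"
    using V ij isometry_compose by blast
  have "?s \<in> W"
    using ij x by (auto intro!: add_in_W Q_in adjoint_on_unitary_in[OF W U_unitary] in_W)
  then have d: "x - ?s \<in> W"
    using x closed_csubspace_diff[OF W] by blast
  let ?u = "U j (U i x)"
  have "cinner (x - ?s) x = cinner (U j (U i (x - ?s))) ?u"
    using isometry_on_cinner[OF W U_isometry] ij d x in_W by metis
  also have "U j (U i (x - ?s)) = ?u - proj {x. adj ?D x = 0} ?u"
    using U_U_sum_projections[OF ij x] ij
    by (simp add: bounded_clinear_diff[OF bounded_clinear_U])
  also have "cinner (?u - proj {x. adj ?D x = 0} ?u) ?u = cinner (adj ?D ?u) (adj ?D ?u)"
    unfolding proj_kernel_adj[OF D] by (simp add: isometry_adj[OF D, symmetric])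
  finally show "cinner (x - ?s) x \<in> \<real>\<^sub>\<ge>\<^sub>0"
    by (simp add: cinner_self)
qed

text \<open>Partial sums of the last model condition: each further summand enlarges the kernel by
  one factor through \<open>U_proj_kernel\<close>. At \<open>k = Suc n\<close> the kernel is
  \<open>W\<close>.\<close>

lemma op_prod_U_sum:
  assumes "k \<in> {1..Suc n}" and x: "x \<in> W"
  shows "op_prod U (rev [1..<k]) (\<Sum>l = 1..<k.
      op_prod (\<lambda>j. adjoint_on W (U j)) [1..<l] (Q l (op_prod U (rev [1..<l]) x)))
    = proj {x. adj (op_prod V (rev [1..<k])) x = 0} (op_prod U (rev [1..<k]) x)"
proof -
  define a where "a l = op_prod (\<lambda>j. adjoint_on W (U j)) [1..<l] (Q l (op_prod U (rev [1..<l]) x))" for l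
  have "op_prod U (rev [1..<k]) (sum a {1..<k})
    = proj {x. adj (op_prod V (rev [1..<k])) x = 0} (op_prod U (rev [1..<k]) x)"
    using assms(1)
  proof (induction k)
    case (Suc k)
    show ?case
    proof (cases "k = 0")
      \<comment> \<open>The induction starts at the index 1, where lists and sum are empty; at 0 the
        hypothesis on \<open>k\<close> fails.\<close>
      case True
      then have "[1..<Suc k] = []"
        by simp
      then show ?thesis
        by (simp only: rev.simps op_prod_Nil proj_kernel_id) (use True in simp)
    next
      case False
      then have k: "k \<in> {1..n}"
        using Suc.prems by simp
      let ?y = "op_prod U (rev [1..<k]) x"
      have iso: "isometry_on W W (op_prod U (rev [1..<l]))" if "l \<in> {1..n}" for l
        by (rule isometry_on_op_prod) (use that U_unitary in auto)
      have unit: "\<And>j. j \<in> set [1..<l] \<Longrightarrow> unitary_on W W (U j)" if "l \<in> {1..n}" for l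
        using that U_unitary by auto
      have Qy: "Q l (op_prod U (rev [1..<l]) x) \<in> W" if "l \<in> {1..n}" for l
        using Q_in[OF that] isometry_on_in[OF iso[OF that] x] by blast
      have a: "a l \<in> W" if "l \<in> {1..n}" for l
        unfolding a_def by (rule op_prod_adjoint_on_in[OF W unit[OF that] Qy[OF that]])
      have sum_a: "sum a {1..<m} \<in> W" if "m \<le> n" for m
        using that
      proof (induction m)
        case (Suc m)
        then show ?case
          using W a[of m] by (cases "m = 0") (auto simp: closed_csubspace_def)
      qed (use W in \<open>simp add: closed_csubspace_def\<close>)
      \<comment> \<open>The factors with index above \<open>k\<close> complete the \<open>D\<close>
        of \<open>U_proj_kernel\<close> to \<open>C k\<close>.\<close>
      have "op_prod V (rev [1..<k]) \<circ> op_prod V [Suc k..<Suc n] = C k"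
        unfolding op_prod_append[symmetric] C_def
      proof (rule op_prod_V_permute)
        have "[1..<Suc n] = [1..<k] @ k # [Suc k..<Suc n]"
          using k upt_add_eq_append[of 1 k "Suc n - k"] by (simp add: upt_conv_Cons)
        then have "filter (\<lambda>j. j \<noteq> k) [1..<Suc n] = [1..<k] @ [Suc k..<Suc n]"
          by simp
        then show "mset (rev [1..<k] @ [Suc k..<Suc n]) = mset (filter (\<lambda>j. j \<noteq> k) [1..<Suc n])"
          by simp
      qed (use k in auto)
      moreover have "isometry (op_prod V (rev [1..<k]))" "isometry (op_prod V [Suc k..<Suc n])"
        using k by (intro isometry_op_prod_V; auto)+
      ultimately have *: "U k (proj {x. adj (op_prod V (rev [1..<k])) x = 0} ?y) + U k (Q k ?y) =
          proj {x. adj (op_prod V (rev [1..<Suc k])) x = 0} (op_prod U (rev [1..<Suc k]) x)"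
        using U_proj_kernel[OF k _ _ _ isometry_on_in[OF iso[OF k] x]] False
        by (simp add: rev_upt_Suc)
      have "op_prod U (rev [1..<Suc k]) (sum a {1..<Suc k}) =
          U k (op_prod U (rev [1..<k]) (sum a {1..<k} + a k))"
        using False by (simp add: rev_upt_Suc)
      also have "op_prod U (rev [1..<k]) (sum a {1..<k} + a k) =
          op_prod U (rev [1..<k]) (sum a {1..<k}) + op_prod U (rev [1..<k]) (a k)"
        using isometry_on_add[OF iso[OF k]] sum_a a[OF k] k by simp
      also have "op_prod U (rev [1..<k]) (a k) = Q k ?y"
        unfolding a_def by (rule op_prod_adjoint_on[OF W unit[OF k] Qy[OF k]])
      also have "op_prod U (rev [1..<k]) (sum a {1..<k}) = proj {x. adj (op_prod V (rev [1..<k])) x = 0} ?y"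
        using Suc.IH k by simp
      finally show ?thesis
        by (simp only: * bounded_clinear_add[OF bounded_clinear_U[OF k]])
    qed
  qed simp
  then show ?thesis
    by (simp only: a_def[abs_def])
qed

lemma sum_projections_all:
  assumes x: "x \<in> W"
  shows "(\<Sum>l = 1..n. op_prod (\<lambda>j. adjoint_on W (U j)) [1..<l] (Q l (op_prod U (rev [1..<l]) x))) = x"
    (is "?s = x")
proof -
  let ?R = "op_prod U (rev [1..<Suc n])"
  have R: "isometry_on W W ?R"
    by (rule isometry_on_op_prod) (use U_unitary in auto)
  \<comment> \<open>By commutativity the reversed product is \<open>S\<close> too, so
    \<open>?R\<close> is the identity on \<open>W\<close>.\<close>
  have perm: "op_prod V (rev [1..<Suc n]) = S"
    by (rule op_prod_V_permute) auto
  have R_id: "?R y = y" if "y \<in> W" for y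
    using op_prod_U_eq[OF _ _ perm that] op_prod_U_all[OF that]
    by (simp add: atLeastLessThanSuc_atLeastAtMost)
  have a: "op_prod (\<lambda>j. adjoint_on W (U j)) [1..<l] (Q l (op_prod U (rev [1..<l]) x)) \<in> W"
    if l: "l \<in> {1..n}" for l
  proof (rule op_prod_adjoint_on_in[OF W], goal_cases)
    case (1 j)
    then show ?case
      using l U_unitary by auto
  next
    case 2
    have "isometry_on W W (op_prod U (rev [1..<l]))"
      by (rule isometry_on_op_prod) (use U_unitary l in auto)
    then show ?case
      using Q_in[OF l] isometry_on_in x by blast
  qed
  have "?s \<in> W"
    using a
  proof (induction n)
    case (Suc n)
    then show ?case
      using W by (auto simp: closed_csubspace_def)
  qed (use W in \<open>simp add: closed_csubspace_def\<close>)
  have "?R ?s = proj W (?R x)"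
    using op_prod_U_sum[of "Suc n" x] x unfolding perm W_def[symmetric] atLeastLessThanSuc_atLeastAtMost by simp
  then show ?thesis
    using R_id[OF x] R_id[OF \<open>?s \<in> W\<close>] proj_ident[OF W x] by simp
qed

lemma model: "model_isometry n W U Q (\<lambda>i. mult_op (\<lambda>z x. U i (x - Q i x + z *\<^sub>C Q i x)))"
  unfolding model_isometry_def
  by (intro conjI ballI impI refl W U_unitary isometry_factorization.projection_Q[OF factorization] U_commute
      op_prod_U_all sum_projections_commute sum_projections_le sum_projections_all)

end

section \<open>Operators on the Hardy space\<close>

lemma hardy_eqI_eval:
  assumes "\<And>z. z \<in> ball 0 1 \<Longrightarrow> hardy_eval f z = hardy_eval g z"
  shows "f = g"
proof -
  have "hardy_eval f z = hardy_eval g z" for z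
    using assms by (cases "z \<in> ball 0 1") (auto simp: hardy_eval_eq disc_series_def)
  then show ?thesis
    by (simp add: hardy_eval_inject[symmetric] fun_eq_iff)
qed

lemma hardy_eval_sums:
  "z \<in> ball 0 1 \<Longrightarrow> (\<lambda>k. z ^ k *\<^sub>C hardy_coeff f k) sums hardy_eval f z"
  unfolding hardy_eval_eq disc_series_def
  using summable_sums[OF summable_disc_series[OF square_summable_hardy_coeff]] by simp

lemma hardy_eval_add: "hardy_eval (f + g) z = hardy_eval f z + hardy_eval g z"
proof -
  have "hardy_coeff (f + g) = (\<lambda>k. hardy_coeff f k + hardy_coeff g k)"
    by (simp add: hardy_coeff_add fun_eq_iff)
  then show ?thesis
    by (simp add: hardy_eval_eq disc_series_add square_summable_hardy_coeff)
qed

definition hardy_map :: "('a::complex_hilbert_space \<Rightarrow> 'b::complex_hilbert_space) \<Rightarrow> 'a hardy \<Rightarrow> 'b hardy" where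
  "hardy_map T f = Abs_hardy (disc_series (\<lambda>k. T (hardy_coeff f k)))"

text \<open>This is the function \<open>e + z f(z)\<close>; \<open>hardy_cons e 0\<close> is the
  constant \<open>e\<close>.\<close>

definition hardy_cons :: "'a::complex_hilbert_space \<Rightarrow> 'a hardy \<Rightarrow> 'a hardy" where
  "hardy_cons e f = Abs_hardy (disc_series (case_nat e (hardy_coeff f)))"

abbreviation hardy_shift :: "'a::complex_hilbert_space hardy \<Rightarrow> 'a hardy" where
  "hardy_shift \<equiv> hardy_cons 0"

lemma hardy_coeff_map:
  assumes T: "bounded_clinear T"
  shows "hardy_coeff (hardy_map T f) k = T (hardy_coeff f k)"
proof -
  have "bounded_linear T"
    using T by (simp add: bounded_clinear_def)
  then obtain K where K: "\<And>x. norm (T x) \<le> norm x * K"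
    using bounded_linear.bounded by blast
  have "square_summable (\<lambda>k. T (hardy_coeff f k))"
    unfolding square_summable_def
  proof (rule summable_comparison_test'[where N = 0])
    show "summable (\<lambda>k. K\<^sup>2 * (norm (hardy_coeff f k))\<^sup>2)"
      using square_summable_hardy_coeff[of f] by (intro summable_mult) (simp add: square_summable_def)
    fix k
    have "(norm (T (hardy_coeff f k)))\<^sup>2 \<le> (norm (hardy_coeff f k) * K)\<^sup>2"
      by (rule power_mono[OF K norm_ge_zero])
    then show "norm ((norm (T (hardy_coeff f k)))\<^sup>2) \<le> K\<^sup>2 * (norm (hardy_coeff f k))\<^sup>2"
      by (simp add: power_mult_distrib mult.commute)
  qed
  then show ?thesis
    by (simp add: hardy_map_def hardy_coeff_Abs)
qed

lemma hardy_coeff_cons: "hardy_coeff (hardy_cons e f) k = (case k of 0 \<Rightarrow> e | Suc m \<Rightarrow> hardy_coeff f m)"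
proof -
  have "square_summable (case_nat e (hardy_coeff f))"
    using square_summable_hardy_coeff[of f] unfolding square_summable_def
    by (subst summable_Suc_iff[symmetric]) simp
  then show ?thesis
    by (simp add: hardy_cons_def hardy_coeff_Abs)
qed

lemma hardy_eval_map:
  assumes T: "bounded_clinear T" and z: "z \<in> ball 0 1"
  shows "hardy_eval (hardy_map T f) z = T (hardy_eval f z)"
proof -
  have "(\<lambda>k. T (z ^ k *\<^sub>C hardy_coeff f k)) sums T (hardy_eval f z)"
    using T by (intro bounded_linear.sums[OF _ hardy_eval_sums[OF z]]) (simp add: bounded_clinear_def)
  moreover have "(\<lambda>k. T (z ^ k *\<^sub>C hardy_coeff f k)) sums hardy_eval (hardy_map T f) z"
    using hardy_eval_sums[OF z, of "hardy_map T f"]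
    by (simp add: hardy_coeff_map[OF T] bounded_clinear_scaleC[OF T])
  ultimately show ?thesis
    by (rule sums_unique2[symmetric])
qed

lemma hardy_eval_cons:
  assumes z: "z \<in> ball 0 1"
  shows "hardy_eval (hardy_cons e f) z = e + z *\<^sub>C hardy_eval f z"
proof -
  have "(\<lambda>k. z *\<^sub>C z ^ k *\<^sub>C hardy_coeff f k) sums (z *\<^sub>C hardy_eval f z)"
    by (rule bounded_linear.sums[OF bounded_linear_scaleC hardy_eval_sums[OF z]])
  then have "(\<lambda>k. z ^ Suc k *\<^sub>C hardy_coeff (hardy_cons e f) (Suc k)) sums (z *\<^sub>C hardy_eval f z)"
    by (simp add: hardy_coeff_cons scaleC_scaleC)
  from sums_unique2[OF hardy_eval_sums[OF z] sums_Suc[OF this]] show ?thesis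
    by (simp add: hardy_coeff_cons add.commute)
qed

lemma norm_hardy_sums: "(\<lambda>k. (norm (hardy_coeff f k))\<^sup>2) sums (norm f)\<^sup>2"
  using sums_norm_hardy[of f] by (simp add: power2_norm_eq_inner)

lemma norm_hardy_const: "norm (hardy_cons e 0) = norm e"
proof -
  have "(\<lambda>k. (norm (hardy_coeff (hardy_cons e 0) k))\<^sup>2) sums (norm e)\<^sup>2"
    using sums_single[of 0 "\<lambda>_. (norm e)\<^sup>2"]
    by (rule back_subst[where P = "\<lambda>f. f sums (norm e)\<^sup>2"])
      (auto simp: hardy_coeff_cons hardy_coeff_zero fun_eq_iff split: nat.split)
  from sums_unique2[OF this norm_hardy_sums] show ?thesis
    by simp
qed

lemma cinner_hardy_cons:
  "cinner (hardy_cons d f) (hardy_cons e g) = cinner d e + cinner f g"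
proof -
  have "(\<lambda>k. cinner (hardy_coeff (hardy_cons d f) (Suc k)) (hardy_coeff (hardy_cons e g) (Suc k))) sums cinner f g"
    using sums_cinner_hardy[of f g] by (simp add: hardy_coeff_cons)
  from sums_unique2[OF sums_cinner_hardy sums_Suc[OF this]] show ?thesis
    by (simp add: hardy_coeff_cons add.commute)
qed

lemma hardy_cons_cases: obtains e g where "f = hardy_cons e g"
proof
  define g where "g = Abs_hardy (disc_series (\<lambda>k. hardy_coeff f (Suc k)))"
  have "square_summable (\<lambda>k. hardy_coeff f (Suc k))"
    using square_summable_hardy_coeff[of f]
    by (simp add: square_summable_def summable_Suc_iff[of "\<lambda>k. (norm (hardy_coeff f k))\<^sup>2"])
  then have "hardy_coeff g = (\<lambda>k. hardy_coeff f (Suc k))"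
    by (simp add: g_def hardy_coeff_Abs)
  then show "f = hardy_cons (hardy_coeff f 0) g"
    by (intro hardy_eqI) (simp add: hardy_coeff_cons split: nat.split)
qed

text \<open>\<open>hardy_map (proj E)\<close> acts as \<open>proj E\<close> both on coefficients and
  on values, so either membership says that it fixes \<open>f\<close>.\<close>

lemma H2_iff:
  assumes E: "closed_csubspace E"
  shows "f \<in> H2 E \<longleftrightarrow> (\<forall>k. hardy_coeff f k \<in> E)"
proof
  assume f: "f \<in> H2 E"
  have "hardy_map (proj E) f = f"
    using f proj_ident[OF E] hardy_eval_map[OF bounded_clinear_proj[OF E]]
    by (intro hardy_eqI_eval) (simp add: H2_def)
  then show "\<forall>k. hardy_coeff f k \<in> E"
    using hardy_coeff_map[OF bounded_clinear_proj[OF E], of f] proj_in[OF E] by metis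
next
  assume f: "\<forall>k. hardy_coeff f k \<in> E"
  then have "hardy_map (proj E) f = f"
    using proj_ident[OF E] hardy_coeff_map[OF bounded_clinear_proj[OF E]] by (intro hardy_eqI) simp
  then show "f \<in> H2 E"
    using hardy_eval_map[OF bounded_clinear_proj[OF E], of _ f] proj_in[OF E] by (auto simp: H2_def) metis
qed

lemma H2_UNIV: "H2 UNIV = UNIV"
  by (simp add: H2_def)

lemma mult_op_eqI:
  assumes "\<And>z. z \<in> ball 0 1 \<Longrightarrow> hardy_eval g z = \<Phi> z (hardy_eval f z)"
  shows "mult_op \<Phi> f = g"
  unfolding mult_op_def by (rule the_equality) (use assms in \<open>auto intro: hardy_eqI_eval\<close>)

text \<open>The symbol has degree at most one in \<open>z\<close>, so an explicit element of the
  Hardy space has the required values; \<open>mult_op\<close> is thus well defined for it.\<close>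

lemma
  assumes U: "bounded_clinear U" and Q: "bounded_clinear Q"
  shows mult_op_pencil: "mult_op (\<lambda>z x. U (x - Q x + z *\<^sub>C Q x)) f =
      hardy_map (\<lambda>x. U (x - Q x)) f + hardy_shift (hardy_map (\<lambda>x. U (Q x)) f)" (is "mult_op ?\<Phi> f = ?g")
    and hardy_eval_mult_op_pencil: "z \<in> ball 0 1 \<Longrightarrow>
      hardy_eval (mult_op (\<lambda>z x. U (x - Q x + z *\<^sub>C Q x)) f) z =
      U (hardy_eval f z - Q (hardy_eval f z) + z *\<^sub>C Q (hardy_eval f z))"
proof -
  have UQ: "bounded_clinear (\<lambda>x. U (Q x))" "bounded_clinear (\<lambda>x. U (x - Q x))"
    by (intro bounded_clinear_compose[OF U] bounded_clinear_minus bounded_clinear_ident Q)+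
  have eval: "hardy_eval ?g z = ?\<Phi> z (hardy_eval f z)" if "z \<in> ball 0 1" for z
    unfolding hardy_eval_add hardy_eval_cons[OF that] hardy_eval_map[OF UQ(1) that] hardy_eval_map[OF UQ(2) that]
    by (simp only: bounded_clinear_simps[OF U] add_0)
  show g: "mult_op ?\<Phi> f = ?g"
    by (rule mult_op_eqI) (rule eval)
  show "hardy_eval (mult_op ?\<Phi> f) z = ?\<Phi> z (hardy_eval f z)" if "z \<in> ball 0 1"
    unfolding g by (rule eval[OF that])
qed

section \<open>The Wold decomposition of a shift\<close>

locale wold_shift =
  fixes S :: "'a::complex_hilbert_space \<Rightarrow> 'a" and W :: "'a set"
  assumes shift: "shift S" and W_def: "W = {x. adj S x = 0}"
begin

text \<open>If \<open>x\<close> is the sum of the \<open>(S ^^ k) (c k)\<close> with square-summable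
  \<open>c\<close> in \<open>W\<close>, this is \<open>c k\<close>; see
  \<open>wold_coeff_sum\<close>.\<close>

definition "wold_coeff x k = proj W ((adj S ^^ k) x)"
definition "wold_map x = Abs_hardy (disc_series (wold_coeff x))"

lemma S: "isometry S"
  using shift by (simp add: shift_def)

lemma W: "closed_csubspace W"
  unfolding W_def by (rule closed_csubspace_kernel_adj[OF S])

lemma proj_W: "proj W x = x - S (adj S x)"
  unfolding W_def by (rule proj_kernel_adj[OF S])

lemmas linS = bounded_clinear_simps[OF isometry_bounded_clinear[OF S]] adj_isometry[OF S]
  bounded_clinear_simps[OF bounded_clinear_adj[OF S]]

lemma wold_coeff_simps [simp]:
  "wold_coeff x 0 = proj W x" "wold_coeff x (Suc k) = wold_coeff (adj S x) k"
  by (simp_all add: wold_coeff_def funpow_swap1)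

lemma adj_W: "x \<in> W \<Longrightarrow> adj S x = 0"
  by (simp add: W_def)

lemma orthogonal_W: "x \<in> W \<Longrightarrow> cinner x (S y) = 0"
  by (simp add: isometry_adj_left[OF S, symmetric] adj_W)

lemma wold_coeff_add: "wold_coeff (x + y) k = wold_coeff x k + wold_coeff y k"
  by (induction k arbitrary: x y) (simp_all add: linS bounded_clinear_simps[OF bounded_clinear_proj[OF W]])

lemma wold_coeff_scaleC: "wold_coeff (c *\<^sub>C x) k = c *\<^sub>C wold_coeff x k"
  by (induction k arbitrary: x) (simp_all add: linS bounded_clinear_simps[OF bounded_clinear_proj[OF W]])

lemma wold_coeff_zero: "wold_coeff 0 k = 0"
  using wold_coeff_scaleC[of 0 0 k] by simp

lemma wold_coeff_in: "wold_coeff x k \<in> W"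
  by (simp add: wold_coeff_def proj_in[OF W])

lemma proj_W_add_S: "x \<in> W \<Longrightarrow> proj W (x + S y) = x"
  by (simp add: proj_W linS adj_W)

text \<open>The squared norm of \<open>(adj S ^^ k) x\<close> drops at each step by the squared norm
  of the \<open>k\<close>-th coefficient. It tends to 0 because \<open>S\<close> is a shift, so the
  series telescopes.\<close>

lemma norm_wold_coeff_sums: "(\<lambda>k. (norm (wold_coeff x k))\<^sup>2) sums (norm x)\<^sup>2"
proof -
  have "(\<lambda>k. (norm ((adj S ^^ k) x))\<^sup>2) \<longlonglongrightarrow> 0"
    using shift tendsto_power[OF tendsto_norm, of "\<lambda>k. (adj S ^^ k) x" 0 sequentially 2]
    by (simp add: shift_def)
  from telescope_sums'[OF this]
  have "(\<lambda>k. (norm ((adj S ^^ k) x))\<^sup>2 - (norm ((adj S ^^ Suc k) x))\<^sup>2) sums (norm x)\<^sup>2"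
    by simp
  moreover have "(norm ((adj S ^^ k) x))\<^sup>2 - (norm ((adj S ^^ Suc k) x))\<^sup>2 = (norm (wold_coeff x k))\<^sup>2" for k
  proof -
    let ?y = "(adj S ^^ k) x"
    have "(norm (proj W ?y + S (adj S ?y)))\<^sup>2 = (norm (proj W ?y))\<^sup>2 + (norm (S (adj S ?y)))\<^sup>2"
      by (rule norm_add_orthogonal[OF orthogonal_W[OF proj_in[OF W]]])
    then show ?thesis
      by (simp add: wold_coeff_def isometry_norm[OF S]) (simp add: proj_W)
  qed
  ultimately show ?thesis
    by simp
qed

lemma hardy_coeff_wold_map: "hardy_coeff (wold_map x) k = wold_coeff x k"
  using sums_summable[OF norm_wold_coeff_sums[of x]]
  by (simp add: wold_map_def hardy_coeff_Abs square_summable_def)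

lemma norm_wold_map: "norm (wold_map x) = norm x"
  using sums_unique2[OF norm_hardy_sums norm_wold_coeff_sums[of x, folded hardy_coeff_wold_map]] by simp

lemma bounded_clinear_S_funpow: "bounded_clinear (S ^^ k)"
proof (induction k)
  case (Suc k)
  then show ?case
    using bounded_clinear_compose[OF isometry_bounded_clinear[OF S]] by (simp add: comp_def)
qed (simp add: bounded_clinear_def id_def)

text \<open>\<open>W\<close> is orthogonal to the range of \<open>S\<close>. Splitting off degree 0
  leaves \<open>S\<close> applied to the sum for the shifted sequence, so \<open>c\<close> varies in
  the induction.\<close>

lemma norm_wold_partial_sum:
  "(\<And>k. c k \<in> W) \<Longrightarrow> (norm (\<Sum>k<m. (S ^^ k) (c k)))\<^sup>2 = (\<Sum>k<m. (norm (c k))\<^sup>2)"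
proof (induction m arbitrary: c)
  case (Suc m)
  have "(\<Sum>k<Suc m. (S ^^ k) (c k)) = c 0 + S (\<Sum>k<m. (S ^^ k) (c (Suc k)))"
    by (simp add: sum.lessThan_Suc_shift bounded_clinear_sum[OF isometry_bounded_clinear[OF S]] del: sum.lessThan_Suc)
  then show ?case
    using norm_add_orthogonal[OF orthogonal_W[OF Suc.prems]] Suc.IH[of "\<lambda>k. c (Suc k)"] Suc.prems
    by (simp add: sum.lessThan_Suc_shift isometry_norm[OF S] del: sum.lessThan_Suc)
qed simp

lemma summable_wold:
  assumes c: "\<And>k. c k \<in> W" "square_summable c"
  shows "summable (\<lambda>k. (S ^^ k) (c k))"
  unfolding summable_Cauchy
proof (intro allI impI)
  fix e :: real
  assume "e > 0"
  have eq: "(norm (\<Sum>k=m..<j. (S ^^ k) (c k)))\<^sup>2 = (\<Sum>k=m..<j. (norm (c k))\<^sup>2)" for m j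
  proof -
    \<comment> \<open>Zeros below \<open>m\<close> turn the block from \<open>m\<close> to
      \<open>j\<close> into an initial partial sum.\<close>
    define d where "d k = (if m \<le> k then c k else 0)" for k
    have "d k \<in> W" for k
      using c(1) W by (simp add: d_def closed_csubspace_def)
    from norm_wold_partial_sum[of d, OF this]
    have "(norm (\<Sum>k<j. (S ^^ k) (d k)))\<^sup>2 = (\<Sum>k<j. (norm (d k))\<^sup>2)" .
    moreover have "(\<Sum>k<j. (S ^^ k) (d k)) = (\<Sum>k=m..<j. (S ^^ k) (c k))"
      by (rule sum.mono_neutral_cong_right) (auto simp: d_def bounded_clinear_zero[OF bounded_clinear_S_funpow])
    moreover have "(\<Sum>k<j. (norm (d k))\<^sup>2) = (\<Sum>k=m..<j. (norm (c k))\<^sup>2)"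
      by (rule sum.mono_neutral_cong_right) (auto simp: d_def)
    ultimately show ?thesis
      by simp
  qed
  obtain N where N: "\<And>m j. m \<ge> N \<Longrightarrow> norm (\<Sum>k=m..<j. (norm (c k))\<^sup>2) < e\<^sup>2"
    using c(2) \<open>e > 0\<close> unfolding square_summable_def summable_Cauchy by (meson zero_less_power)
  have "norm (\<Sum>k=m..<j. (S ^^ k) (c k)) < e" if "m \<ge> N" for m j
  proof -
    have "(norm (\<Sum>k=m..<j. (S ^^ k) (c k)))\<^sup>2 < e\<^sup>2"
      unfolding eq using N[OF that, of j] by simp
    then show ?thesis
      by (rule power2_less_imp_less) (use \<open>e > 0\<close> in simp)
  qed
  then show "\<exists>N. \<forall>m\<ge>N. \<forall>j. norm (\<Sum>k=m..<j. (S ^^ k) (c k)) < e"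
    by blast
qed

lemma wold_suminf_split:
  assumes c: "\<And>k. c k \<in> W" "square_summable c"
  shows "(\<Sum>j. (S ^^ j) (c j)) = c 0 + S (\<Sum>j. (S ^^ j) (c (Suc j)))"
    and "square_summable (\<lambda>k. c (Suc k))"
proof -
  show c_Suc: "square_summable (\<lambda>k. c (Suc k))"
    using c(2) by (simp add: square_summable_def summable_Suc_iff[of "\<lambda>k. (norm (c k))\<^sup>2"])
  have "summable (\<lambda>j. (S ^^ j) (c (Suc j)))"
    using c(1) c_Suc by (intro summable_wold)
  then have "(\<Sum>j. S ((S ^^ j) (c (Suc j)))) = S (\<Sum>j. (S ^^ j) (c (Suc j)))"
    using isometry_bounded_clinear[OF S] unfolding bounded_clinear_def
    by (metis bounded_linear.suminf)
  then show "(\<Sum>j. (S ^^ j) (c j)) = c 0 + S (\<Sum>j. (S ^^ j) (c (Suc j)))"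
    using suminf_split_head[OF summable_wold[OF c]] by simp
qed

text \<open>\<open>adj S\<close> deletes the first entry of the sequence. This provides preimages
  under \<open>wold_map\<close>.\<close>

lemma wold_coeff_sum:
  assumes "\<And>k. c k \<in> W" "square_summable c"
  shows "wold_coeff (\<Sum>j. (S ^^ j) (c j)) k = c k"
  using assms
proof (induction k arbitrary: c)
  case (0 c)
  then show ?case
    by (simp add: wold_suminf_split(1)[OF 0] proj_W_add_S)
next
  case (Suc k c)
  have "adj S (\<Sum>j. (S ^^ j) (c j)) = (\<Sum>j. (S ^^ j) (c (Suc j)))"
    using Suc.prems(1) by (simp add: wold_suminf_split(1)[OF Suc.prems] linS adj_W)
  then show ?case
    using Suc.IH[OF Suc.prems(1) wold_suminf_split(2)[OF Suc.prems]] by simp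
qed

lemma unitary_wold_map: "unitary_on UNIV (H2 W) wold_map"
  unfolding unitary_on_def isometry_on_def
proof (intro conjI ballI equalityI subsetI)
  show "clinear_on UNIV wold_map"
    unfolding clinear_on_def
    by (auto intro!: hardy_eqI simp: hardy_coeff_wold_map hardy_coeff_add hardy_coeff_scaleC wold_coeff_add
        wold_coeff_scaleC)
next
  fix f
  assume f: "f \<in> H2 W"
  then have "wold_coeff (\<Sum>j. (S ^^ j) (hardy_coeff f j)) k = hardy_coeff f k" for k
    by (intro wold_coeff_sum square_summable_hardy_coeff) (simp add: H2_iff[OF W])
  then have "f = wold_map (\<Sum>j. (S ^^ j) (hardy_coeff f j))"
    by (intro hardy_eqI) (simp add: hardy_coeff_wold_map)
  then show "f \<in> range wold_map"
    by blast
qed (auto simp: norm_wold_map H2_iff[OF W] hardy_coeff_wold_map wold_coeff_in)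

end

locale shift_factorization = isometry_factorization A B S U Q W + wold: wold_shift S W
  for A B S U Q :: "'a::complex_hilbert_space \<Rightarrow> 'a" and W
begin

text \<open>Splitting \<open>x\<close> into \<open>proj W x + S (adj S x)\<close> and expanding
  \<open>A (proj W x)\<close> by \<open>A_eq\<close> gives a recursion for the coefficients of
  \<open>A x\<close>, which the two-term form in \<open>mult_op_pencil\<close> also
  satisfies.\<close>

lemma wold_map_A: "wold.wold_map (A x) = mult_op (\<lambda>z x. U (x - Q x + z *\<^sub>C Q x)) (wold.wold_map x)"
proof -
  have UQ: "bounded_clinear (\<lambda>x. U (Q x))" "bounded_clinear (\<lambda>x. U (x - Q x))"
    by (intro bounded_clinear_compose[OF bounded_clinear_U] bounded_clinear_minus bounded_clinear_ident
        bounded_clinear_Q)+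
  have coeff_W: "wold.wold_coeff w k = (case k of 0 \<Rightarrow> w | Suc m \<Rightarrow> 0)" if "w \<in> W" for w k
    using that by (cases k) (simp_all add: wold.wold_coeff_zero wold.adj_W proj_ident[OF W])
  have decomp: "U (proj W x - Q (proj W x)) \<in> W" "U (Q (proj W x)) \<in> W"
    "A x = U (proj W x - Q (proj W x)) + S (U (Q (proj W x)) + A (adj S x))" for x
  proof -
    let ?c = "proj W x" and ?y = "adj S x"
    have c: "?c \<in> W"
      by (rule proj_in[OF W])
    then show "U (?c - Q ?c) \<in> W" "U (Q ?c) \<in> W"
      using U_in Q_in closed_csubspace_diff[OF W] by blast+
    have "A x = A (?c + S ?y)"
      by (simp add: wold.proj_W)
    also have "\<dots> = U (?c - Q ?c) + S (U (Q ?c) + A ?y)"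
      using A_eq[of ?c] by (simp add: lin BA)
    finally show "A x = U (?c - Q ?c) + S (U (Q ?c) + A ?y)" .
  qed
  have "wold.wold_coeff (A x) k = U (wold.wold_coeff x k - Q (wold.wold_coeff x k)) +
      (case k of 0 \<Rightarrow> 0 | Suc m \<Rightarrow> U (Q (wold.wold_coeff x m)))" for k
  proof (induction k arbitrary: x)
    case (0 x)
    show ?case
      using wold.proj_W_add_S[OF decomp(1)[of x]] decomp(3)[of x] by simp
  next
    case (Suc k x)
    \<comment> \<open>As a vector of \<open>W\<close>, the extra term has no coefficient beyond
      index 0, so it enters \<open>A x\<close> only at index 1.\<close>
    have "adj S (A x) = U (Q (proj W x)) + A (adj S x)"
      unfolding decomp(3)[of x] using wold.adj_W[OF decomp(1)[of x]] by (simp add: wold.linS)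
    then show ?case
      using Suc.IH[of "adj S x"] coeff_W[OF decomp(2)[of x], of k]
      by (simp add: wold.wold_coeff_add split: nat.split)
  qed
  then show ?thesis
    unfolding mult_op_pencil[OF bounded_clinear_U bounded_clinear_Q]
    by (intro hardy_eqI)
      (simp add: wold.hardy_coeff_wold_map hardy_coeff_add hardy_coeff_cons hardy_coeff_map[OF UQ(1)]
        hardy_coeff_map[OF UQ(2)] split: nat.split)
qed

end

section \<open>The product of a model tuple\<close>

lemma bounded_clinear_op_prod:
  "(\<And>j. j \<in> set js \<Longrightarrow> bounded_clinear (A j)) \<Longrightarrow> bounded_clinear (op_prod A js)"
  by (induction js)
    (simp_all add: bounded_clinear_compose comp_def bounded_clinear_ident[folded id_def])

lemma projection_on_UNIV: "projection_on UNIV P \<Longrightarrow> \<exists>T. closed_csubspace T \<and> P = proj T"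
  unfolding projection_on_def by (auto simp: fun_eq_iff)

text \<open>
  The operators \<open>A k = (U\<^sub>1\<^sup>* \<dots> U\<^sub>k\<^sub>-\<^sub>1\<^sup>*) P k (U\<^sub>k\<^sub>-\<^sub>1 \<dots> U\<^sub>1)\<close> are projections with sum 1, hence mutually orthogonal, and
  moving all unitaries to the left turns the product of the symbols into the product of the \<open>1 - A k + z A k\<close>.
\<close>

lemma model_symbol_product:
  fixes U P :: "nat \<Rightarrow> 'a::complex_hilbert_space \<Rightarrow> 'a"
  assumes model: "model_isometry n UNIV U P M"
  shows "op_prod (\<lambda>i x. U i (x - P i x + z *\<^sub>C P i x)) (rev [1..<Suc n]) x = z *\<^sub>C x"
proof -
  let ?adj = "\<lambda>j. adj (U j)"
  define A where "A k x = op_prod ?adj [1..<k] (P k (op_prod U (rev [1..<k]) x))" for k x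
  have U: "unitary_on UNIV UNIV (U i)" if "i \<in> {1..n}" for i
    using model that by (simp add: model_isometry_def)
  have isoU: "isometry (U i)" if "i \<in> {1..n}" for i
    using U[OF that] by (simp add: unitary_on_def)
  have R: "isometry (op_prod U (rev [1..<k]))" if "k \<le> Suc n" for k
    by (rule isometry_op_prod) (use that isoU in auto)
  have "\<exists>T. closed_csubspace T \<and> P i = proj T" if "i \<in> {1..n}" for i
    using model that projection_on_UNIV[of "P i"] by (auto simp: model_isometry_def)
  then obtain T where T: "\<And>i. i \<in> {1..n} \<Longrightarrow> closed_csubspace (T i)" "\<And>i. i \<in> {1..n} \<Longrightarrow> P i = proj (T i)"
    by metis
  have linP: "bounded_clinear (P i)" and PP: "P i (P i x) = P i x"
    and Pself: "cinner (P i x) x = cinner (P i x) (P i x)" if "i \<in> {1..n}" for i x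
    using T[OF that] by (simp_all add: bounded_clinear_proj proj_ident proj_in cinner_proj_self)
  have RA: "op_prod U (rev [1..<k]) (A k x) = P k (op_prod U (rev [1..<k]) x)" if k: "k \<in> {1..n}" for k x
    unfolding A_def by (rule op_prod_adjoint_on[OF closed_csubspace_UNIV]) (use k U in auto)
  have linA: "bounded_clinear (A k)" if k: "k \<in> {1..n}" for k
  proof -
    have "bounded_clinear (op_prod ?adj [1..<k])"
      by (rule bounded_clinear_op_prod) (use k in \<open>auto intro!: bounded_clinear_adj isoU\<close>)
    moreover have "bounded_clinear (op_prod U (rev [1..<k]))"
      using isometry_bounded_clinear[OF R] k by simp
    ultimately show ?thesis
      unfolding A_def[abs_def] by (rule bounded_clinear_compose[OF _ bounded_clinear_compose[OF linP[OF k]]])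
  qed
  have A_idem: "A k (A k x) = A k x" if k: "k \<in> {1..n}" for k x
    unfolding A_def[of k "A k x"] RA[OF k] PP[OF k] by (simp only: A_def)
  have A_self: "cinner (A k x) x = of_real ((norm (A k x))\<^sup>2)" if k: "k \<in> {1..n}" for k x
  proof -
    have R_k: "isometry (op_prod U (rev [1..<k]))"
      using R k by simp
    show ?thesis
      unfolding cinner_self[symmetric]
      using isometry_cinner[OF R_k, of "A k x" x] isometry_cinner[OF R_k, of "A k x" "A k x"]
      unfolding RA[OF k] by (simp only: Pself[OF k])
  qed
  have sum_A: "(\<Sum>k = 1..n. A k x) = x" for x
    using model by (simp add: model_isometry_def A_def)
  have sum_norm: "(\<Sum>k = 1..n. (norm (A k x))\<^sup>2) = (norm x)\<^sup>2" for x
  proof -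
    have "cinner (\<Sum>k = 1..n. A k x) x = (\<Sum>k = 1..n. cinner (A k x) x)"
      by (rule linear_sum[OF bounded_linear.linear[OF bounded_linear_cinner_left]])
    also have "\<dots> = of_real (\<Sum>k = 1..n. (norm (A k x))\<^sup>2)"
      unfolding of_real_sum by (intro sum.cong refl A_self)
    finally show ?thesis
      unfolding sum_A cinner_self by (simp only: of_real_eq_iff)
  qed
  \<comment> \<open>For the vector \<open>A k x\<close> the term of index \<open>k\<close> already
    exhausts the squared norm, so the other terms vanish.\<close>
  have A_orth: "A j (A k x) = 0" if jk: "j \<in> {1..n}" "k \<in> {1..n}" "j \<noteq> k" for j k x
  proof -
    have "(\<Sum>l\<in>{1..n} - {k}. (norm (A l (A k x)))\<^sup>2) = 0"
      using sum_norm[of "A k x"] sum.remove[OF _ jk(2), of "\<lambda>l. (norm (A l (A k x)))\<^sup>2"] A_idem[OF jk(2)]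
      by simp
    then show ?thesis
      using jk by (simp add: sum_nonneg_eq_0_iff)
  qed
  have "op_prod (\<lambda>i x. U i (x - P i x + z *\<^sub>C P i x)) (rev [1..<k]) x =
      op_prod U (rev [1..<k]) (x - (\<Sum>j = 1..<k. A j x) + z *\<^sub>C (\<Sum>j = 1..<k. A j x))"
    if "k \<le> Suc n" for k
    using that
  proof (induction k)
    case (Suc k)
    show ?case
    proof (cases "k = 0")
      case False
      then have k: "k \<in> {1..n}"
        using Suc.prems by simp
      let ?R = "op_prod U (rev [1..<k])" and ?s = "\<Sum>j = 1..<k. A j x"
      have R_k: "bounded_clinear ?R"
        using isometry_bounded_clinear[OF R] k by simp
      let ?y = "x - ?s + z *\<^sub>C ?s"
      \<comment> \<open>\<open>A k\<close> kills the earlier projections, so \<open>P k\<close> sees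
        only the new component.\<close>
      have "A k ?s = 0"
        unfolding bounded_clinear_sum[OF linA[OF k]] using k by (intro sum.neutral) (auto intro!: A_orth)
      then have "A k ?y = A k x"
        by (simp add: bounded_clinear_simps[OF linA[OF k]])
      then have P_y: "P k (?R ?y) = ?R (A k x)"
        using RA[OF k, of ?y] by simp
      have "op_prod (\<lambda>i x. U i (x - P i x + z *\<^sub>C P i x)) (rev [1..<Suc k]) x =
          U k (?R ?y - P k (?R ?y) + z *\<^sub>C P k (?R ?y))"
        using Suc False by simp
      also have "\<dots> = U k (?R (?y - A k x + z *\<^sub>C A k x))"
        unfolding P_y by (simp only: bounded_clinear_simps[OF R_k])
      also have "?y - A k x + z *\<^sub>C A k x = x - (?s + A k x) + z *\<^sub>C (?s + A k x)"
        by (simp add: scaleC_add_right)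
      finally show ?thesis
        using False by simp
    qed simp
  qed simp
  from this[of "Suc n"] have "op_prod (\<lambda>i x. U i (x - P i x + z *\<^sub>C P i x)) (rev [1..<Suc n]) x =
      op_prod U (rev [1..<Suc n]) (z *\<^sub>C x)"
    unfolding atLeastLessThanSuc_atLeastAtMost sum_A by simp
  also have "op_prod U (rev [1..<Suc n]) = op_prod U [1..<Suc n]"
  proof (rule op_prod_permute)
    fix i j
    assume "i \<in> set (rev [1..<Suc n])" "j \<in> set (rev [1..<Suc n])"
    then have "i \<in> {1..n}" "j \<in> {1..n}"
      by auto
    then show "U i \<circ> U j = U j \<circ> U i"
      using model by (simp add: model_isometry_def fun_eq_iff)
  qed simp
  also have "op_prod U [1..<Suc n] (z *\<^sub>C x) = z *\<^sub>C x"
    using model unfolding model_isometry_def by blast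
  finally show ?thesis .
qed

lemma hardy_eval_op_prod:
  assumes "\<And>i f. i \<in> set js \<Longrightarrow> hardy_eval (M i f) z = \<Phi> i (hardy_eval f z)"
  shows "hardy_eval (op_prod M js f) z = op_prod \<Phi> js (hardy_eval f z)"
  using assms by (induction js) simp_all

section \<open>Unitary maps between Hardy spaces\<close>

lemma unitary_on_compose:
  "unitary_on S T A \<Longrightarrow> unitary_on R S B \<Longrightarrow> unitary_on R T (A \<circ> B)"
  unfolding unitary_on_def by (auto intro: isometry_on_compose simp: image_comp[symmetric])

text \<open>\<open>X\<close> is controlled only on \<open>E\<close>; composing it with
  \<open>proj E\<close> gives a bounded map on the whole space, which can act on
  coefficients.\<close>

lemma unitary_hardy_map:
  assumes E: "closed_csubspace E" and X: "unitary_on E UNIV X"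
  shows "bounded_clinear (\<lambda>x. X (proj E x))" "unitary_on (H2 E) UNIV (hardy_map (\<lambda>x. X (proj E x)))"
proof -
  have iso: "isometry_on E UNIV X"
    using X by (simp add: unitary_on_def)
  note P = bounded_clinear_proj[OF E] and P_in = proj_in[OF E] and P_id = proj_ident[OF E]
  show T: "bounded_clinear (\<lambda>x. X (proj E x))"
  proof -
    obtain K where K: "\<And>x. norm (proj E x) \<le> norm x * K"
      using P bounded_linear.bounded unfolding bounded_clinear_def by blast
    then have "norm (X (proj E x)) \<le> norm x * K" for x
      using iso P_in by (simp add: isometry_on_def)
    moreover have "clinear_on UNIV (\<lambda>x. X (proj E x))"
      using isometry_on_add[OF iso] isometry_on_scaleC[OF iso] P_in
      by (simp add: clinear_on_def bounded_clinear_simps[OF P])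
    ultimately show ?thesis
      by (intro bounded_clinearI)
  qed
  show "unitary_on (H2 E) UNIV (hardy_map (\<lambda>x. X (proj E x)))"
    unfolding unitary_on_def isometry_on_def
  proof (intro conjI ballI equalityI subsetI UNIV_I)
    show "clinear_on (H2 E) (hardy_map (\<lambda>x. X (proj E x)))"
      unfolding clinear_on_def
      by (auto intro!: hardy_eqI simp: hardy_coeff_map[OF T] hardy_coeff_add hardy_coeff_scaleC
          bounded_clinear_add[OF T] bounded_clinear_scaleC[OF T])
    fix f
    assume f: "f \<in> H2 E"
    then have "norm (hardy_coeff (hardy_map (\<lambda>x. X (proj E x)) f) k) = norm (hardy_coeff f k)" for k
      using iso by (simp add: hardy_coeff_map[OF T] H2_iff[OF E] P_id isometry_on_def)
    then have "(\<lambda>k. (norm (hardy_coeff f k))\<^sup>2) sums (norm (hardy_map (\<lambda>x. X (proj E x)) f))\<^sup>2"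
      using norm_hardy_sums[of "hardy_map (\<lambda>x. X (proj E x)) f"] by simp
    from sums_unique2[OF this norm_hardy_sums]
    show "norm (hardy_map (\<lambda>x. X (proj E x)) f) = norm f"
      by simp
  next
    fix g :: "'b hardy"
    define c where "c k = inv_into E X (hardy_coeff g k)" for k
    have "hardy_coeff g k \<in> X ` E" for k
      using X by (simp add: unitary_on_def)
    then have c: "c k \<in> E" "X (c k) = hardy_coeff g k" for k
      by (simp_all add: c_def inv_into_into f_inv_into_f)
    have "norm (c k) = norm (hardy_coeff g k)" for k
      using iso c by (metis isometry_on_def)
    then have "square_summable c"
      using square_summable_hardy_coeff[of g] by (simp add: square_summable_def)
    then have coeff: "hardy_coeff (Abs_hardy (disc_series c)) = c"
      by (rule hardy_coeff_Abs)
    have "g = hardy_map (\<lambda>x. X (proj E x)) (Abs_hardy (disc_series c))"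
      by (rule hardy_eqI) (simp add: hardy_coeff_map[OF T] coeff P_id c)
    moreover have "Abs_hardy (disc_series c) \<in> H2 E"
      by (simp add: H2_iff[OF E] coeff c)
    ultimately show "g \<in> hardy_map (\<lambda>x. X (proj E x)) ` H2 E"
      by (rule image_eqI)
  qed
qed

lemma model_bounded_clinear:
  assumes "model_isometry n UNIV U P M" "i \<in> {1..n}"
  shows "isometry (U i)" "bounded_clinear (U i)" "bounded_clinear (P i)"
proof -
  show iso: "isometry (U i)"
    using assms by (simp add: model_isometry_def unitary_on_def)
  then show "bounded_clinear (U i)"
    by (rule isometry_bounded_clinear)
  obtain T where "closed_csubspace T" "P i = proj T"
    using assms projection_on_UNIV[of "P i"] by (auto simp: model_isometry_def)
  then show "bounded_clinear (P i)"
    by (simp add: bounded_clinear_proj)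
qed

section \<open>Unitary equivalence with model tuples\<close>

context isometry_tuple
begin

lemma wold_shift: "wold_shift S W"
  using n_isometry by unfold_locales (simp_all add: n_isometry_def W_def)

abbreviation "wold_map \<equiv> wold_shift.wold_map S W"

lemma wold_map_V:
  "i \<in> {1..n} \<Longrightarrow> wold_map (V i x) = mult_op (\<lambda>z x. U i (x - Q i x + z *\<^sub>C Q i x)) (wold_map x)"
  by (rule shift_factorization.wold_map_A[OF shift_factorization.intro[OF factorization wold_shift]])

lemma unitarily_equivalent_model:
  "unitarily_equivalent n UNIV V (H2 W) (\<lambda>i. mult_op (\<lambda>z x. U i (x - Q i x + z *\<^sub>C Q i x)))"
  using wold_map_V wold_shift.unitary_wold_map[OF wold_shift] unfolding unitarily_equivalent_def by blast

text \<open>The Wold map followed by \<open>X\<close> on each coefficient is the required unitary.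
  The intertwining is checked at each \<open>z\<close> of the disc, where the values lie in
  \<open>W\<close> and the hypotheses on \<open>X\<close> apply.\<close>

lemma unitarily_equivalentI:
  fixes U' P' :: "nat \<Rightarrow> 'b::complex_hilbert_space \<Rightarrow> 'b"
  assumes model': "model_isometry n UNIV U' P' M" and X: "unitary_on W UNIV X"
    and XU: "\<And>i x. i \<in> {1..n} \<Longrightarrow> x \<in> W \<Longrightarrow> X (U i x) = U' i (X x)"
    and XQ: "\<And>i x. i \<in> {1..n} \<Longrightarrow> x \<in> W \<Longrightarrow> X (Q i x) = P' i (X x)"
  shows "unitarily_equivalent n UNIV V (H2 UNIV) (\<lambda>i. mult_op (\<lambda>z x. U' i (x - P' i x + z *\<^sub>C P' i x)))"
proof -
  let ?T = "\<lambda>x. X (proj W x)"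
  note T = unitary_hardy_map[OF W X]
  note wold = wold_shift.unitary_wold_map[OF wold_shift]
  have iso: "isometry_on W UNIV X"
    using X by (simp add: unitary_on_def)
  have "hardy_map ?T (wold_map (V i x)) =
      mult_op (\<lambda>z x. U' i (x - P' i x + z *\<^sub>C P' i x)) (hardy_map ?T (wold_map x))" if i: "i \<in> {1..n}" for i x
  proof (rule hardy_eqI_eval)
    fix z :: complex
    assume z: "z \<in> ball 0 1"
    note M' = model_bounded_clinear[OF model' i]
    let ?w = "hardy_eval (wold_map x) z"
    have "wold_map x \<in> H2 W"
      using wold by (auto simp: unitary_on_def)
    then have w: "?w \<in> W"
      using z by (simp add: H2_def)
    note Qw = Q_in[OF i w]
    have zQ: "z *\<^sub>C Q i ?w \<in> W"
      using Qw W by (simp add: closed_csubspace_def)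
    have d: "?w - Q i ?w \<in> W"
      by (rule closed_csubspace_diff[OF W w Qw])
    let ?v = "?w - Q i ?w + z *\<^sub>C Q i ?w"
    have v: "?v \<in> W"
      by (rule add_in_W[OF d zQ])
    have "hardy_eval (hardy_map ?T (wold_map (V i x))) z = X (proj W (U i ?v))"
      by (simp only: hardy_eval_map[OF T(1) z] wold_map_V[OF i]
          hardy_eval_mult_op_pencil[OF bounded_clinear_U[OF i] bounded_clinear_Q[OF i] z])
    also have "\<dots> = X (U i ?v)"
      by (simp only: proj_ident[OF W isometry_on_in[OF U_isometry[OF i] v]])
    also have "\<dots> = U' i (X ?v)"
      by (rule XU[OF i v])
    also have "X ?v = X ?w - P' i (X ?w) + z *\<^sub>C P' i (X ?w)"
      by (simp only: isometry_on_add[OF iso d zQ] isometry_on_diff[OF W iso w Qw] isometry_on_scaleC[OF iso Qw]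
          XQ[OF i w])
    also have "X ?w = hardy_eval (hardy_map ?T (wold_map x)) z"
      by (simp only: hardy_eval_map[OF T(1) z] proj_ident[OF W w])
    also have "U' i (hardy_eval (hardy_map ?T (wold_map x)) z - P' i (hardy_eval (hardy_map ?T (wold_map x)) z) +
        z *\<^sub>C P' i (hardy_eval (hardy_map ?T (wold_map x)) z)) =
        hardy_eval (mult_op (\<lambda>z x. U' i (x - P' i x + z *\<^sub>C P' i x)) (hardy_map ?T (wold_map x))) z"
      by (simp only: hardy_eval_mult_op_pencil[OF M'(2,3) z])
    finally show "hardy_eval (hardy_map ?T (wold_map (V i x))) z =
        hardy_eval (mult_op (\<lambda>z x. U' i (x - P' i x + z *\<^sub>C P' i x)) (hardy_map ?T (wold_map x))) z" .
  qed
  then show ?thesis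
    using unitary_on_compose[OF T(2) wold] unfolding unitarily_equivalent_def H2_UNIV
    by (intro exI[of _ "hardy_map ?T \<circ> wold_map"]) simp
qed

lemma unitarily_equivalentD:
  fixes U' P' :: "nat \<Rightarrow> 'b::complex_hilbert_space \<Rightarrow> 'b"
  assumes model': "model_isometry n UNIV U' P' M"
    and eq: "unitarily_equivalent n UNIV V (H2 UNIV) (\<lambda>i. mult_op (\<lambda>z x. U' i (x - P' i x + z *\<^sub>C P' i x)))"
  obtains X where "unitary_on W UNIV X"
    "\<And>i x. i \<in> {1..n} \<Longrightarrow> x \<in> W \<Longrightarrow> X (U i x) = U' i (X x) \<and> X (Q i x) = P' i (X x)"
proof -
  define M' where "M' i = mult_op (\<lambda>z x. U' i (x - P' i x + z *\<^sub>C P' i x))" for i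
  note lin' = model_bounded_clinear[OF model']
  from eq obtain Y where Y: "unitary_on UNIV UNIV Y" "\<And>i x. i \<in> {1..n} \<Longrightarrow> Y (V i x) = M' i (Y x)"
    unfolding unitarily_equivalent_def H2_UNIV M'_def by blast
  have isoY: "isometry Y"
    using Y(1) by (simp add: unitary_on_def)
  note linY = bounded_clinear_simps[OF isometry_bounded_clinear[OF isoY]]
  have Y_prod: "Y (op_prod V js x) = op_prod M' js (Y x)" if "set js \<subseteq> {1..n}" for js x
    using that by (induction js) (simp_all add: Y(2))
  \<comment> \<open>By \<open>model_symbol_product\<close> the symbols multiply to \<open>z\<close>,
    so the product of the model operators is \<open>hardy_shift\<close>.\<close>
  have Y_S: "Y (S x) = hardy_shift (Y x)" for x
  proof (rule hardy_eqI_eval)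
    fix z :: complex
    assume z: "z \<in> ball 0 1"
    have "S = op_prod V (rev [1..<Suc n])"
      by (rule op_prod_V_permute) auto
    then have "Y (S x) = op_prod M' (rev [1..<Suc n]) (Y x)"
      using Y_prod[of "rev [1..<Suc n]" x] by (auto simp: atLeastLessThanSuc_atLeastAtMost)
    moreover have "hardy_eval (op_prod M' (rev [1..<Suc n]) (Y x)) z =
        op_prod (\<lambda>i x. U' i (x - P' i x + z *\<^sub>C P' i x)) (rev [1..<Suc n]) (hardy_eval (Y x) z)"
      unfolding M'_def
    proof (rule hardy_eval_op_prod)
      fix i f
      assume "i \<in> set (rev [1..<Suc n])"
      then have "i \<in> {1..n}"
        by auto
      then show "hardy_eval (mult_op (\<lambda>z x. U' i (x - P' i x + z *\<^sub>C P' i x)) f) z =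
          U' i (hardy_eval f z - P' i (hardy_eval f z) + z *\<^sub>C P' i (hardy_eval f z))"
        using hardy_eval_mult_op_pencil[OF lin'(2,3) z] by blast
    qed
    ultimately show "hardy_eval (Y (S x)) z = hardy_eval (hardy_shift (Y x)) z"
      by (simp only: model_symbol_product[OF model'] hardy_eval_cons[OF z] add_0)
  qed
  define X where "X w = hardy_coeff (Y w) 0" for w
  \<comment> \<open>If \<open>Y w\<close> is \<open>e + z g\<close> with \<open>g = Y v\<close>,
    then \<open>z g\<close> is the image of \<open>S v\<close>, which is orthogonal to
    \<open>w\<close>; so \<open>g\<close> is orthogonal to itself.\<close>
  have Y_W: "Y w = hardy_cons (X w) 0" if "w \<in> W" for w
  proof -
    obtain e g where eg: "Y w = hardy_cons e g"
      by (rule hardy_cons_cases)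
    obtain v where v: "g = Y v"
      using Y(1) by (metis UNIV_I imageE unitary_on_def)
    have "cinner w (S v) = 0"
      unfolding isometry_adj_left[OF S, symmetric] using that by (simp add: W_def)
    then have "cinner (Y w) (Y (S v)) = 0"
      by (simp add: isometry_cinner[OF isoY])
    then have "g = 0"
      unfolding Y_S eg v[symmetric] cinner_hardy_cons by simp
    then show ?thesis
      by (simp add: X_def eg hardy_coeff_cons)
  qed
  have "unitary_on W UNIV X"
    unfolding unitary_on_def isometry_on_def
  proof (intro conjI ballI equalityI subsetI UNIV_I)
    show "clinear_on W X"
      by (simp add: clinear_on_def X_def linY hardy_coeff_add hardy_coeff_scaleC)
    show "norm (X w) = norm w" if "w \<in> W" for w
      using Y_W[OF that] isometry_norm[OF isoY, of w] norm_hardy_const by metis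
  next
    fix e :: 'b
    obtain w where w: "hardy_cons e 0 = Y w"
      using Y(1) by (metis UNIV_I imageE unitary_on_def)
    \<comment> \<open>Constants are orthogonal to the range of \<open>hardy_shift\<close>, so their
      preimages are orthogonal to the range of \<open>S\<close>.\<close>
    have "cinner (adj S w) (adj S w) = cinner (Y w) (Y (S (adj S w)))"
      by (simp only: isometry_adj_left[OF S] isometry_cinner[OF isoY])
    also have "\<dots> = 0"
      unfolding Y_S w[symmetric] cinner_hardy_cons by simp
    finally have "w \<in> W"
      by (simp add: W_def)
    moreover have "e = X w"
      by (simp add: X_def w[symmetric] hardy_coeff_cons)
    ultimately show "e \<in> X ` W"
      by blast
  qed
  moreover have X_Q: "X (U i (Q i w)) = U' i (P' i (X w))" and X_U: "X (U i w) = U' i (X w)"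
    if i: "i \<in> {1..n}" and w: "w \<in> W" for i w
  proof -
    note M = lin'[OF i]
    have UQ: "bounded_clinear (\<lambda>x. U' i (P' i x))" "bounded_clinear (\<lambda>x. U' i (x - P' i x))"
      by (intro bounded_clinear_compose[OF M(2)] bounded_clinear_minus bounded_clinear_ident M(3))+
    have Qw: "Q i w \<in> W"
      by (rule Q_in[OF i w])
    have UPw: "U i (w - Q i w) \<in> W" and UQw: "U i (Q i w) \<in> W"
      using isometry_on_in[OF U_isometry[OF i]] closed_csubspace_diff[OF W w Qw] Qw by blast+
    \<comment> \<open>Two expansions of degree at most one, from \<open>V_eq\<close> and from the
      symbol of the model; their coefficients 0 and 1 are compared below.\<close>
    have "Y (V i w) = hardy_cons (X (U i (w - Q i w))) 0 + hardy_shift (hardy_cons (X (U i (Q i w))) 0)"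
      by (simp only: V_eq[OF i, of w] linY(1) Y_S Y_W[OF UPw] Y_W[OF UQw])
    moreover have "Y (V i w) = hardy_map (\<lambda>x. U' i (x - P' i x)) (hardy_cons (X w) 0) +
        hardy_shift (hardy_map (\<lambda>x. U' i (P' i x)) (hardy_cons (X w) 0))"
      unfolding Y(2)[OF i] M'_def mult_op_pencil[OF M(2,3)] Y_W[OF w] ..
    ultimately have *: "hardy_coeff (hardy_cons (X (U i (w - Q i w))) 0 + hardy_shift (hardy_cons (X (U i (Q i w))) 0)) k =
        hardy_coeff (hardy_map (\<lambda>x. U' i (x - P' i x)) (hardy_cons (X w) 0) +
        hardy_shift (hardy_map (\<lambda>x. U' i (P' i x)) (hardy_cons (X w) 0))) k" for k
      by simp
    have e0: "X (U i (w - Q i w)) = U' i (X w - P' i (X w))"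
      using *[of 0] by (simp add: hardy_coeff_add hardy_coeff_cons hardy_coeff_map[OF UQ(2)])
    show e1: "X (U i (Q i w)) = U' i (P' i (X w))"
      using *[of 1]
      by (simp add: hardy_coeff_add hardy_coeff_cons hardy_coeff_map[OF UQ(1)] hardy_coeff_map[OF UQ(2)]
          hardy_coeff_zero bounded_clinear_zero[OF M(2)] bounded_clinear_zero[OF M(3)])
    have "X (x + y) = X x + X y" for x y
      by (simp add: X_def linY hardy_coeff_add)
    from this[of "U i (w - Q i w)" "U i (Q i w)"]
    have "X (U i (w - Q i w) + U i (Q i w)) = U' i (X w - P' i (X w)) + U' i (P' i (X w))"
      by (simp only: e0 e1)
    then show "X (U i w) = U' i (X w)"
      by (simp add: bounded_clinear_diff[OF bounded_clinear_U[OF i]] bounded_clinear_diff[OF M(2)])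
  qed
  moreover have "X (Q i w) = P' i (X w)" if i: "i \<in> {1..n}" and w: "w \<in> W" for i w
    \<comment> \<open>Applying \<open>U' i\<close> to both sides gives the same vector, and
      \<open>U' i\<close> is injective.\<close>
    using X_Q[OF i w] X_U[OF i Q_in[OF i w]] isometry_on_inj[OF closed_csubspace_UNIV lin'(1)[OF i]] by simp
  ultimately show thesis
    using that by blast
qed

end

theorem corollary3p3:
  fixes n :: nat
    and V Vt U :: "nat \<Rightarrow> 'a::complex_hilbert_space \<Rightarrow> 'a"
    and W :: "'a set" and Wt :: "nat \<Rightarrow> 'a set"
    and \<Phi> :: "nat \<Rightarrow> complex \<Rightarrow> 'a \<Rightarrow> 'a"
    and Ut Pt :: "nat \<Rightarrow> 'b::complex_hilbert_space \<Rightarrow> 'b"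
    and \<Psi> :: "nat \<Rightarrow> complex \<Rightarrow> 'b \<Rightarrow> 'b"
  assumes "n \<ge> 2"
    and "n_isometry n V"
    and W: "W = {x. adjoint_on UNIV (op_prod V [1..<Suc n]) x = 0}"
    and Vt: "\<And>i. Vt i = op_prod V (filter (\<lambda>j. j \<noteq> i) [1..<Suc n])"
    and Wt: "\<And>i. Wt i = {x. adjoint_on UNIV (Vt i) x = 0}"
    and U: "\<And>i x. U i x = proj W (V i x) + adjoint_on UNIV (Vt i) x"
    and \<Phi>: "\<And>i z x. \<Phi> i z x = U i (proj (Wt i) x + z *\<^sub>C (x - proj (Wt i) x))"
    and \<Psi>: "\<And>i z x. \<Psi> i z x = Ut i ((x - Pt i x) + z *\<^sub>C Pt i x)"
    and "model_isometry n UNIV Ut Pt (\<lambda>i. mult_op (\<Psi> i))"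
  shows "model_isometry n W U (\<lambda>i x. x - proj (Wt i) x) (\<lambda>i. mult_op (\<Phi> i)) \<and>
    unitarily_equivalent n UNIV V (H2 W) (\<lambda>i. mult_op (\<Phi> i)) \<and>
    (unitarily_equivalent n UNIV V (H2 UNIV) (\<lambda>i. mult_op (\<Psi> i)) \<longleftrightarrow>
      (\<exists>X. unitary_on W UNIV X \<and>
         (\<forall>i\<in>{1..n}. \<forall>x\<in>W. X (U i x) = Ut i (X x) \<and> X (x - proj (Wt i) x) = Pt i (X x))))"
proof -
  let ?Q = "\<lambda>i x. x - proj (Wt i) x"
  interpret isometry_tuple n V Vt U ?Q W
    by unfold_locales (use assms in \<open>simp_all only: Wt\<close>)
  \<comment> \<open>\<open>proj (Wt i)\<close> is the complement of \<open>?Q i\<close>, so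
    \<open>\<Phi> i\<close> takes the form of a model symbol.\<close>
  have \<Phi>': "mult_op (\<Phi> i) = mult_op (\<lambda>z x. U i (x - ?Q i x + z *\<^sub>C ?Q i x))" for i
    by (rule arg_cong[of _ _ mult_op]) (simp add: \<Phi> fun_eq_iff)
  have \<Psi>': "mult_op (\<Psi> i) = mult_op (\<lambda>z x. Ut i (x - Pt i x + z *\<^sub>C Pt i x))" for i
    by (rule arg_cong[of _ _ mult_op]) (simp add: \<Psi> fun_eq_iff)
  show ?thesis
    unfolding \<Phi>' \<Psi>'
  proof (intro conjI iffI)
    assume "unitarily_equivalent n UNIV V (H2 UNIV) (\<lambda>i. mult_op (\<lambda>z x. Ut i (x - Pt i x + z *\<^sub>C Pt i x)))"
    from unitarily_equivalentD[OF assms(9) this]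
    show "\<exists>X. unitary_on W UNIV X \<and>
        (\<forall>i\<in>{1..n}. \<forall>x\<in>W. X (U i x) = Ut i (X x) \<and> X (?Q i x) = Pt i (X x))"
      by metis
  next
    assume "\<exists>X. unitary_on W UNIV X \<and>
        (\<forall>i\<in>{1..n}. \<forall>x\<in>W. X (U i x) = Ut i (X x) \<and> X (?Q i x) = Pt i (X x))"
    then show "unitarily_equivalent n UNIV V (H2 UNIV) (\<lambda>i. mult_op (\<lambda>z x. Ut i (x - Pt i x + z *\<^sub>C Pt i x)))"
      using unitarily_equivalentI[OF assms(9)] by blast
  qed (rule model unitarily_equivalent_model)+
qed

end
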